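(* For all compositions $\alpha,\beta$ of $n$ and $N\ge n$, the coefficient of $G_\beta(x_1,\ldots,x_N;t)$ in the expansion of the quasisymmetric Schur polynomial $\mathcal{S}_\alpha(x_1,\ldots,x_N)$ in the basis $\{G_\gamma\}$ is $\sum_{T\in\mathrm{SSCT}(\alpha,\beta)}t^{\mathrm{SumAsc}(T)}$.
   Context: The diagram of a composition $\alpha$ has $\alpha_i$ left-justified boxes in row $i$ (top to bottom), cells $(i,j)$ in matrix coordinates. A filling $T$ of this diagram with positive integers is a semistandard composition tableau (SSCT) if: (C1) rows weakly decrease left to right; (C2) the leftmost column strictly increases top to bottom; (C3) (triple rule) for cells $(i,k),(j,k)$ in the same column with $i<j$: if $\alpha_i\ge\alpha_j$ then $T(j,k)<T(i,k)$ or $T(i,k-1)<T(j,k)$; if $\alpha_i<\alpha_j$ then $T(j,k)<T(i,k)$ or $T(i,k)<T(j,k+1)$. $\mathrm{SSCT}(\alpha,\beta)$ is the set of SSCT of shape $\alpha$ in which, for each $i$, the value $i$ appears exactly $\beta_i$ times ($i\le\ell(\beta)$) and no other values appear. $\mathcal{S}_\alpha(x_1,\ldots,x_N)=\sum_T\prod_c x_{T(c)}$ over SSCT of shape $\alpha$ with entries in $[N]$. For an SSCT $T$, $\mathrm{Asc}(T)$ is the set of values $i$ such that the leftmost occurrence of $i$ is strictly to the right of the rightmost occurrence of $i+1$, and $\mathrm{SumAsc}(T)=\sum_{i\in\mathrm{Asc}(T)}i$. With $\mathrm{sub}(\gamma)$ the set of proper partial sums of $\gamma$, $\gamma\succeq\alpha$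 iff $\mathrm{sub}(\alpha)\subseteq\mathrm{sub}(\gamma)$; if so, writing $\alpha_j=\gamma_{i_{j-1}+1}+\cdots+\gamma_{i_j}$ ($0=i_0<\dots<i_k=\ell(\gamma)$), $s(\alpha,\gamma)=\sum_j j(i_j-i_{j-1}-1)$. $F_\alpha(x_1,\ldots,x_N)=\sum x_{w_1}\cdots x_{w_n}$ over $1\le w_1\le\dots\le w_n\le N$ with $w_j<w_{j+1}$ for $j\in\mathrm{sub}(\alpha)$, and Hivert's quasisymmetric Hall–Littlewood polynomials are $G_\alpha(x_1,\ldots,x_N;t)=\sum_{\gamma\succeq\alpha}(-1)^{\ell(\gamma)-\ell(\alpha)}t^{s(\alpha,\gamma)}F_\gamma$. *)

theory Defs
  imports
    "HOL-Library.FuncSet"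
    "HOL-Library.Poly_Mapping"
    "HOL-Computational_Algebra.Polynomial"
begin

section \<open>Compositions\<close>

definition comps :: "nat \<Rightarrow> nat list set" where
  "comps n = {\<alpha>. (\<forall>a\<in>set \<alpha>. 1 \<le> a) \<and> sum_list \<alpha> = n}"

text \<open>Parts, rows, columns and partial sums are all indexed from 1 upwards, as on paper.\<close>

definition part :: "nat list \<Rightarrow> nat \<Rightarrow> nat" where
  "part \<alpha> i = \<alpha> ! (i - 1)"

definition proper_sums :: "nat list \<Rightarrow> nat set" where
  "proper_sums \<gamma> = {sum_list (take i \<gamma>) | i. 1 \<le> i \<and> i < length \<gamma>}"

definition refines :: "nat list \<Rightarrow> nat list \<Rightarrow> bool" where
  "refines \<gamma> \<alpha> \<longleftrightarrow> sum_list \<gamma> = sum_list \<alpha> \<and> proper_sums \<alpha> \<subseteq> proper_sums \<gamma>"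

text \<open>If \<open>\<gamma>\<close> refines \<open>\<alpha>\<close>, then \<open>block_end \<alpha> \<gamma> j\<close> is the index \<open>i\<^sub>j\<close> with
  \<open>\<alpha>\<^sub>1 + \<dots> + \<alpha>\<^sub>j = \<gamma>\<^sub>1 + \<dots> + \<gamma>\<^sub>i\<close> for \<open>i = i\<^sub>j\<close>; it is unique because parts are positive,
  and \<open>block_end \<alpha> \<gamma> 0 = 0\<close>. The subtractions in \<open>s_stat\<close> never truncate,
  since \<open>i\<^sub>j\<close> is strictly increasing in \<open>j\<close>.\<close>

definition block_end :: "nat list \<Rightarrow> nat list \<Rightarrow> nat \<Rightarrow> nat" where
  "block_end \<alpha> \<gamma> j =
     (THE i. i \<le> length \<gamma> \<and> sum_list (take i \<gamma>) = sum_list (take j \<alpha>))"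

definition s_stat :: "nat list \<Rightarrow> nat list \<Rightarrow> nat" where
  "s_stat \<alpha> \<gamma> =
     (\<Sum>j = 1..length \<alpha>. j * (block_end \<alpha> \<gamma> j - block_end \<alpha> \<gamma> (j - 1) - 1))"


section \<open>Semistandard composition tableaux\<close>

definition diagram :: "nat list \<Rightarrow> (nat \<times> nat) set" where
  "diagram \<alpha> = {(i, j). 1 \<le> i \<and> i \<le> length \<alpha> \<and> 1 \<le> j \<and> j \<le> part \<alpha> i}"

text \<open>Fillings are extensional functions on the diagram, so distinct functions are distinct
  fillings. In the triple rule for \<open>\<alpha>\<^sub>i \<ge> \<alpha>\<^sub>j\<close> the cell \<open>(i, k - 1)\<close> does not exist when
  \<open>k = 1\<close>; the rule then imposes no condition (equivalently, \<open>T (i, 0) = 0\<close>). In the case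
  \<open>\<alpha>\<^sub>i < \<alpha>\<^sub>j\<close> the cell \<open>(j, k + 1)\<close> always exists, as \<open>k \<le> \<alpha>\<^sub>i\<close>.\<close>

definition ssct :: "nat list \<Rightarrow> (nat \<times> nat \<Rightarrow> nat) \<Rightarrow> bool" where
  "ssct \<alpha> T \<longleftrightarrow>
     T \<in> diagram \<alpha> \<rightarrow>\<^sub>E {1..} \<and>
     (\<forall>i j k. j < k \<and> (i, j) \<in> diagram \<alpha> \<and> (i, k) \<in> diagram \<alpha> \<longrightarrow> T (i, k) \<le> T (i, j)) \<and>
     (\<forall>i j. i < j \<and> (i, 1) \<in> diagram \<alpha> \<and> (j, 1) \<in> diagram \<alpha> \<longrightarrow> T (i, 1) < T (j, 1)) \<and>
     (\<forall>i j k. i < j \<and> (i, k) \<in> diagram \<alpha> \<and> (j, k) \<in> diagram \<alpha> \<longrightarrow>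
        (if part \<alpha> i \<ge> part \<alpha> j
         then k > 1 \<longrightarrow> T (j, k) < T (i, k) \<or> T (i, k - 1) < T (j, k)
         else T (j, k) < T (i, k) \<or> T (i, k) < T (j, k + 1)))"

definition SSCT :: "nat list \<Rightarrow> nat list \<Rightarrow> (nat \<times> nat \<Rightarrow> nat) set" where
  "SSCT \<alpha> \<beta> =
     {T. ssct \<alpha> T \<and> T ` diagram \<alpha> \<subseteq> {1..length \<beta>} \<and>
         (\<forall>i\<in>{1..length \<beta>}. card {c \<in> diagram \<alpha>. T c = i} = part \<beta> i)}"

definition columns_of :: "nat list \<Rightarrow> (nat \<times> nat \<Rightarrow> nat) \<Rightarrow> nat \<Rightarrow> nat set" where
  "columns_of \<alpha> T v = {k. \<exists>r. (r, k) \<in> diagram \<alpha> \<and> T (r, k) = v}"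

text \<open>Only values \<open>i\<close> such that both \<open>i\<close> and \<open>i + 1\<close> occur in the tableau can be ascents.\<close>

definition Asc :: "nat list \<Rightarrow> (nat \<times> nat \<Rightarrow> nat) \<Rightarrow> nat set" where
  "Asc \<alpha> T =
     {i. columns_of \<alpha> T i \<noteq> {} \<and> columns_of \<alpha> T (i + 1) \<noteq> {} \<and>
         Max (columns_of \<alpha> T (i + 1)) < Min (columns_of \<alpha> T i)}"

definition SumAsc :: "nat list \<Rightarrow> (nat \<times> nat \<Rightarrow> nat) \<Rightarrow> nat" where
  "SumAsc \<alpha> T = \<Sum>(Asc \<alpha> T)"


section \<open>Quasisymmetric polynomials\<close>

text \<open>Polynomials in \<open>x\<^sub>1, x\<^sub>2, \<dots>\<close> over \<open>\<int>[t]\<close>: finitely supported maps from exponent vectors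
  (themselves finitely supported maps) to coefficients.\<close>

type_synonym xpoly = "(nat \<Rightarrow>\<^sub>0 nat) \<Rightarrow>\<^sub>0 int poly"

definition X :: "nat \<Rightarrow> xpoly" where
  "X i = Poly_Mapping.single (Poly_Mapping.single i 1) 1"

definition const :: "int poly \<Rightarrow> xpoly" where
  "const c = Poly_Mapping.single 0 c"

definition t :: "int poly" where
  "t = [:0, 1:]"

definition quasi_schur :: "nat \<Rightarrow> nat list \<Rightarrow> xpoly" where
  "quasi_schur N \<alpha> =
     (\<Sum>T\<in>{T. ssct \<alpha> T \<and> T ` diagram \<alpha> \<subseteq> {1..N}}. \<Prod>c\<in>diagram \<alpha>. X (T c))"

definition fundamental :: "nat \<Rightarrow> nat list \<Rightarrow> xpoly" where
  "fundamental N \<alpha> =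
     (\<Sum>w\<in>{w. length w = sum_list \<alpha> \<and> set w \<subseteq> {1..N} \<and> sorted w \<and>
              (\<forall>j\<in>proper_sums \<alpha>. w ! (j - 1) < w ! j)}. prod_list (map X w))"

definition hivert_G :: "nat \<Rightarrow> nat list \<Rightarrow> xpoly" where
  "hivert_G N \<alpha> =
     (\<Sum>\<gamma>\<in>{\<gamma> \<in> comps (sum_list \<alpha>). refines \<gamma> \<alpha>}.
        const ((- 1) ^ (length \<gamma> - length \<alpha>) * t ^ s_stat \<alpha> \<gamma>) * fundamental N \<gamma>)"

text \<open>\<open>a\<close> lists the coefficients of \<open>f\<close>, homogeneous of degree \<open>n\<close>, in an expansion in the
  polynomials \<open>G\<^sub>\<gamma>(x\<^sub>1, \<dots>, x\<^sub>N; t)\<close>. Coefficients outside \<open>comps n\<close> are set to zero only so that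
  the function \<open>a\<close> itself can be unique.\<close>

definition G_expansion :: "nat \<Rightarrow> nat \<Rightarrow> xpoly \<Rightarrow> (nat list \<Rightarrow> int poly) \<Rightarrow> bool" where
  "G_expansion N n f a \<longleftrightarrow>
     (\<forall>\<gamma>. \<gamma> \<notin> comps n \<longrightarrow> a \<gamma> = 0) \<and>
     f = (\<Sum>\<gamma>\<in>comps n. const (a \<gamma>) * hivert_G N \<gamma>)"

end

theory Submission
  imports Defs
begin

text \<open>Standardization: ordering the cells of a tableau by entry, and cells with equal entries from
  right to left, writes it uniquely as a weakly increasing word \<open>w\<close> relabelling a standard tableau
  \<open>S\<close>, where \<open>w\<close> increases strictly at the descents of \<open>S\<close> (those \<open>p\<close> for which \<open>p + 1\<close> lies
  weakly to the right of \<open>p\<close>). Hence the quasisymmetric Schur polynomial is the sum of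
  \<open>F\<^bsub>Des S\<^esub>\<close> over the standard tableaux \<open>S\<close>. With compositions encoded by their sets of partial
  sums, inverting the definition of \<open>G\<close> shows that \<open>F\<^sub>A\<close> is the sum over \<open>C \<supseteq> A\<close> of
  \<open>t\<^bsup>e(A, C)\<^esup> G\<^sub>C\<close>, where \<open>e(A, C)\<close> adds up the positions in \<open>C\<close> of the elements of \<open>C - A\<close>.
  The tableaux in \<open>SSCT(\<alpha>, \<beta>)\<close> correspond to the \<open>S\<close> with \<open>Des S \<subseteq> sub(\<beta>)\<close>, and their ascents are the positions in \<open>sub(\<beta>)\<close> of the elements
  outside \<open>Des S\<close>.\<close>

section \<open>Compositions and subsets\<close>

definition psum :: "nat list \<Rightarrow> nat \<Rightarrow> nat" where
  "psum \<gamma> i = sum_list (take i \<gamma>)"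

lemma psum_0 [simp]: "psum \<gamma> 0 = 0"
  by (simp add: psum_def)

lemma psum_Suc: "i < length \<gamma> \<Longrightarrow> psum \<gamma> (Suc i) = psum \<gamma> i + \<gamma> ! i"
  by (simp add: psum_def take_Suc_conv_app_nth)

lemma psum_length: "\<gamma> \<in> comps n \<Longrightarrow> psum \<gamma> (length \<gamma>) = n"
  by (simp add: psum_def comps_def)

lemma psum_less:
  assumes "\<gamma> \<in> comps n" "i < j" "j \<le> length \<gamma>"
  shows "psum \<gamma> i < psum \<gamma> j"
  using assms(2,3)
proof (induction j)
  case (Suc j)
  have "\<gamma> ! j \<ge> 1"
    using assms(1) Suc.prems by (auto simp: comps_def)
  with Suc show ?case
    by (cases "i = j") (auto simp: psum_Suc)
qed simp

lemma psum_less_iff: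
  assumes "\<gamma> \<in> comps n" "i \<le> length \<gamma>" "j \<le> length \<gamma>"
  shows "psum \<gamma> i < psum \<gamma> j \<longleftrightarrow> i < j"
  using psum_less[OF assms(1)] assms(2,3) by (metis less_asym less_irrefl linorder_less_linear)

lemma psum_le_iff:
  assumes "\<gamma> \<in> comps n" "i \<le> length \<gamma>" "j \<le> length \<gamma>"
  shows "psum \<gamma> i \<le> psum \<gamma> j \<longleftrightarrow> i \<le> j"
  using psum_less_iff[OF assms(1,3,2)] by linarith

lemma psum_eq_iff:
  assumes "\<gamma> \<in> comps n" "i \<le> length \<gamma>" "j \<le> length \<gamma>"
  shows "psum \<gamma> i = psum \<gamma> j \<longleftrightarrow> i = j"
  using psum_le_iff[OF assms] psum_le_iff[OF assms(1,3,2)] by auto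

lemma inj_on_psum: "\<gamma> \<in> comps n \<Longrightarrow> inj_on (psum \<gamma>) {..length \<gamma>}"
  by (auto simp: inj_on_def psum_eq_iff)

section \<open>Compositions of \<open>n\<close> and subsets of \<open>{1..<n}\<close>\<close>

lemma proper_sums_eq: "proper_sums \<gamma> = psum \<gamma> ` {1..<length \<gamma>}"
  by (auto simp: proper_sums_def psum_def image_def)

lemma finite_proper_sums [simp]: "finite (proper_sums \<gamma>)"
  by (simp add: proper_sums_eq)

lemma comps_0: "comps 0 = {[]}"
proof -
  have "\<gamma> = []" if "\<gamma> \<in> comps 0" for \<gamma>
    using that by (cases \<gamma>) (auto simp: comps_def)
  then show ?thesis
    by (auto simp: comps_def)
qed

lemma length_pos_if_comps: "\<gamma> \<in> comps n \<Longrightarrow> 0 < n \<Longrightarrow> 0 < length \<gamma>"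
  by (auto simp: comps_def)

lemma proper_sums_subset:
  assumes "\<gamma> \<in> comps n"
  shows "proper_sums \<gamma> \<subseteq> {1..<n}"
proof
  fix x assume "x \<in> proper_sums \<gamma>"
  then obtain i where i: "1 \<le> i" "i < length \<gamma>" "x = psum \<gamma> i"
    by (auto simp: proper_sums_eq)
  then show "x \<in> {1..<n}"
    using psum_less[OF assms, of 0 i] psum_less[OF assms, of i "length \<gamma>"] psum_length[OF assms]
    by auto
qed

lemma card_proper_sums:
  assumes "\<gamma> \<in> comps n"
  shows "card (proper_sums \<gamma>) = length \<gamma> - 1"
proof -
  have "inj_on (psum \<gamma>) {1..<length \<gamma>}"
    using inj_on_psum[OF assms] by (rule inj_on_subset) auto
  then show ?thesis
    by (simp add: proper_sums_eq card_image)
qed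

text \<open>Listed increasingly, the proper sums give \<open>psum\<close> at all interior indices.
  Together with the end values 0 and \<open>n\<close> they fix every partial sum, and the parts are
  the consecutive differences. The case \<open>n = 0\<close> is split off because there the length
  does not exceed the number of proper sums by one.\<close>

lemma inj_on_proper_sums: "inj_on proper_sums (comps n)"
proof (rule inj_onI)
  fix \<gamma> \<delta> assume g: "\<gamma> \<in> comps n" and d: "\<delta> \<in> comps n" and eq: "proper_sums \<gamma> = proper_sums \<delta>"
  show "\<gamma> = \<delta>"
  proof (cases "n = 0")
    case True
    then show ?thesis using g d comps_0 by auto
  next
    case False
    have sorted: "sorted_wrt (<) (map (psum \<epsilon>) [1..<length \<epsilon>])" if "\<epsilon> \<in> comps n" for \<epsilon>
      using psum_less[OF that] by (auto simp: sorted_wrt_iff_nth_less)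
    have list: "map (psum \<gamma>) [1..<length \<gamma>] = map (psum \<delta>) [1..<length \<delta>]"
      using eq by (intro strict_sorted_equal sorted g d) (simp add: proper_sums_eq)
    have len: "length \<gamma> = length \<delta>"
      using card_proper_sums[OF g] card_proper_sums[OF d, folded eq] length_pos_if_comps[OF g]
        length_pos_if_comps[OF d] False by linarith
    have ps: "psum \<gamma> i = psum \<delta> i" if "i \<le> length \<gamma>" for i
    proof -
      have "i = 0 \<or> i = length \<gamma> \<or> i \<in> {1..<length \<gamma>}"
        using that by auto
      then consider "i = 0" | "i = length \<gamma>" | "i \<in> {1..<length \<gamma>}"
        by blast
      then show ?thesis
      proof cases
        case 2
        then show ?thesis using psum_length[OF g] psum_length[OF d] len by simp
      next
        case 3
        then show ?thesis using list len by simp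
      qed simp
    qed
    show ?thesis
    proof (rule nth_equalityI[OF len])
      fix i assume "i < length \<gamma>"
      then show "\<gamma> ! i = \<delta> ! i"
        using ps[of i] ps[of "Suc i"] psum_Suc[of i \<gamma>] psum_Suc[of i \<delta>] len by simp
    qed
  qed
qed

lemma proper_sums_surj:
  assumes "A \<subseteq> {1..<n}"
  shows "\<exists>\<gamma>\<in>comps n. proper_sums \<gamma> = A"
proof (cases "n = 0")
  case True
  then show ?thesis using assms comps_0 by (auto simp: proper_sums_def)
next
  case False
  \<comment> \<open>The list of all partial sums that the composition must have, both ends included.
    For \<open>n = 0\<close> it would be \<open>[0, 0]\<close>, which is not strictly increasing;
    hence the case split.\<close>
  define xs where "xs = 0 # sorted_list_of_set A @ [n]"
  define m where "m = length xs - 1"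
  define \<gamma> where "\<gamma> = map (\<lambda>i. xs ! Suc i - xs ! i) [0..<m]"
  have fin: "finite A"
    using assms finite_subset by blast
  have sorted: "sorted_wrt (<) xs"
    using assms fin False by (auto simp: xs_def sorted_wrt_append)
  have less: "xs ! i < xs ! Suc i" if "i < m" for i
    using sorted that unfolding sorted_wrt_iff_nth_less m_def by simp
  have ps: "psum \<gamma> i = xs ! i" if "i \<le> m" for i
    using that
  proof (induction i)
    case 0
    then show ?case by (simp add: xs_def)
  next
    case (Suc i)
    then show ?case
      using less[of i] by (simp add: psum_Suc \<gamma>_def)
  qed
  have len: "length \<gamma> = m"
    by (simp add: \<gamma>_def)
  have "sum_list \<gamma> = n"
    using ps[of m] by (simp add: psum_def len m_def xs_def nth_append)
  then have c: "\<gamma> \<in> comps n"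
    using less by (auto simp: comps_def \<gamma>_def Suc_le_eq)
  have "proper_sums \<gamma> = (\<lambda>i. xs ! i) ` {1..<m}"
    unfolding proper_sums_eq len by (rule image_cong) (auto simp: ps)
  also have "\<dots> = set (sorted_list_of_set A)"
  proof -
    have "{1..<m} = Suc ` {0..<m - 1}"
      by (simp add: image_Suc_atLeastLessThan m_def xs_def)
    have "(\<lambda>i. xs ! i) ` {1..<m} = (\<lambda>i. sorted_list_of_set A ! i) ` {0..<m - 1}"
      unfolding \<open>{1..<m} = Suc ` {0..<m - 1}\<close> image_image
      by (intro image_cong) (auto simp: xs_def m_def nth_append)
    also have "\<dots> = set (sorted_list_of_set A)"
      by (auto simp: set_conv_nth m_def xs_def)
    finally show ?thesis .
  qed
  finally show ?thesis
    using c fin by auto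
qed

lemma bij_betw_proper_sums: "bij_betw proper_sums (comps n) (Pow {1..<n})"
proof -
  have "proper_sums ` comps n = Pow {1..<n}"
  proof (intro equalityI subsetI)
    show "A \<in> Pow {1..<n}" if "A \<in> proper_sums ` comps n" for A
      using that proper_sums_subset by blast
    show "A \<in> proper_sums ` comps n" if "A \<in> Pow {1..<n}" for A
      using proper_sums_surj[of A n] that by blast
  qed
  then show ?thesis
    by (simp add: bij_betw_def inj_on_proper_sums)
qed

lemma refines_iff:
  "\<gamma> \<in> comps n \<Longrightarrow> \<alpha> \<in> comps n \<Longrightarrow> refines \<gamma> \<alpha> \<longleftrightarrow> proper_sums \<alpha> \<subseteq> proper_sums \<gamma>"
  by (auto simp: refines_def comps_def)

text \<open>Turns the exponent of the sign in \<open>hivert_G\<close> into the size of a set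
  difference.\<close>

lemma length_diff_eq:
  assumes "\<gamma> \<in> comps n" "\<alpha> \<in> comps n" "proper_sums \<alpha> \<subseteq> proper_sums \<gamma>"
  shows "length \<gamma> - length \<alpha> = card (proper_sums \<gamma> - proper_sums \<alpha>)"
proof (cases "n = 0")
  case True
  then show ?thesis using assms comps_0 by simp
next
  case False
  have "0 < length \<alpha>" "0 < length \<gamma>"
    using length_pos_if_comps assms(1,2) False by auto
  then show ?thesis
    using card_proper_sums[OF assms(1)] card_proper_sums[OF assms(2)] assms(3)
    by (simp add: card_Diff_subset)
qed

section \<open>The part of a composition in which a position lies\<close>

text \<open>If \<open>A\<close> is the set of cut points of a composition, this is the index of the
  part containing position \<open>x\<close>. The strict \<open>y < x\<close> makes a cut point
  belong to the part that it closes, so on elements of \<open>A\<close> the rank is the position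
  within \<open>A\<close>, counted from 1.\<close>

definition rank :: "nat set \<Rightarrow> nat \<Rightarrow> nat" where
  "rank A x = Suc (card {y \<in> A. y < x})"

lemma rank_proper_sums:
  assumes "\<gamma> \<in> comps n" "j < length \<gamma>" "psum \<gamma> j < x" "x \<le> psum \<gamma> (Suc j)"
  shows "rank (proper_sums \<gamma>) x = Suc j"
proof -
  have "{y \<in> proper_sums \<gamma>. y < x} = psum \<gamma> ` {1..j}"
  proof (intro equalityI subsetI)
    fix y assume "y \<in> {y \<in> proper_sums \<gamma>. y < x}"
    then obtain i where i: "1 \<le> i" "i < length \<gamma>" "y = psum \<gamma> i" "y < x"
      by (auto simp: proper_sums_eq)
    then have "psum \<gamma> i < psum \<gamma> (Suc j)"
      using assms(4) by simp
    then have "i \<le> j"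
      using psum_less_iff[OF assms(1), of i "Suc j"] i assms(2) by simp
    then show "y \<in> psum \<gamma> ` {1..j}"
      using i by auto
  next
    fix y assume "y \<in> psum \<gamma> ` {1..j}"
    then obtain i where i: "1 \<le> i" "i \<le> j" "y = psum \<gamma> i"
      by auto
    then have "psum \<gamma> i \<le> psum \<gamma> j"
      using psum_le_iff[OF assms(1), of i j] assms(2) by simp
    then show "y \<in> {y \<in> proper_sums \<gamma>. y < x}"
      using i assms(2,3) by (auto simp: proper_sums_eq)
  qed
  moreover have "inj_on (psum \<gamma>) {1..j}"
    using assms(2) by (intro inj_on_subset[OF inj_on_psum[OF assms(1)]]) auto
  ultimately show ?thesis
    by (simp add: rank_def card_image)
qed

lemma rank_psum:
  assumes "\<gamma> \<in> comps n" "1 \<le> i" "i \<le> length \<gamma>"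
  shows "rank (proper_sums \<gamma>) (psum \<gamma> i) = i"
  using rank_proper_sums[OF assms(1), of "i - 1" "psum \<gamma> i"] psum_less[OF assms(1), of "i - 1" i] assms
  by simp

lemma psum_interval:
  assumes "\<gamma> \<in> comps n" "x \<in> {1..n}"
  obtains j where "j < length \<gamma>" "psum \<gamma> j < x" "x \<le> psum \<gamma> (Suc j)"
proof -
  define i where "i = (LEAST i. x \<le> psum \<gamma> i)"
  have ex: "x \<le> psum \<gamma> (length \<gamma>)"
    using psum_length[OF assms(1)] assms(2) by simp
  have le: "x \<le> psum \<gamma> i"
    unfolding i_def by (rule LeastI, rule ex)
  have "i \<noteq> 0"
    using le assms(2) by (cases "i = 0") auto
  then obtain j where j: "i = Suc j"
    using not0_implies_Suc by blast
  have "i \<le> length \<gamma>"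
    unfolding i_def using ex by (rule Least_le)
  moreover have "\<not> x \<le> psum \<gamma> j"
    by (rule not_less_Least) (simp add: i_def[symmetric] j)
  ultimately show ?thesis
    using that[of j] le j by simp
qed

text \<open>A Galois connection between \<open>rank\<close> and \<open>psum\<close>: position
  \<open>x\<close> lies in one of the first \<open>i\<close> parts iff it does not exceed their
  total. Most later facts about ranks are drawn from it.\<close>

lemma rank_le_iff:
  assumes "\<gamma> \<in> comps n" "x \<in> {1..n}" "i \<le> length \<gamma>"
  shows "rank (proper_sums \<gamma>) x \<le> i \<longleftrightarrow> x \<le> psum \<gamma> i"
proof -
  obtain j where j: "j < length \<gamma>" "psum \<gamma> j < x" "x \<le> psum \<gamma> (Suc j)"
    using psum_interval assms(1,2) by blast
  have "Suc j \<le> i \<Longrightarrow> psum \<gamma> (Suc j) \<le> psum \<gamma> i"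
    using psum_le_iff[OF assms(1), of "Suc j" i] j assms(3) by simp
  moreover have "i \<le> j \<Longrightarrow> psum \<gamma> i \<le> psum \<gamma> j"
    using psum_le_iff[OF assms(1), of i j] j assms(3) by simp
  ultimately show ?thesis
    using rank_proper_sums[OF assms(1) j] j by (cases "Suc j \<le> i") auto
qed

lemma rank_ge_1: "1 \<le> rank A x"
  by (simp add: rank_def)

lemma rank_le_length:
  assumes "\<gamma> \<in> comps n" "x \<in> {1..n}"
  shows "rank (proper_sums \<gamma>) x \<le> length \<gamma>"
  using rank_le_iff[OF assms, of "length \<gamma>"] psum_length[OF assms(1)] assms(2) by simp

lemma rank_mono:
  assumes "finite A" "x \<le> y"
  shows "rank A x \<le> rank A y"
  using assms by (auto simp: rank_def intro!: card_mono)

text \<open>The sets counted for \<open>x\<close> and \<open>Suc x\<close> can differ only in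
  \<open>x\<close> itself. Thus the cut points can be read off as the places where
  \<open>rank\<close> jumps.\<close>

lemma rank_less_Suc_iff:
  assumes "finite A"
  shows "rank A x < rank A (Suc x) \<longleftrightarrow> x \<in> A"
proof -
  have "{y \<in> A. y < Suc x} = (if x \<in> A then insert x {y \<in> A. y < x} else {y \<in> A. y < x})"
    by (auto simp: less_Suc_eq)
  then show ?thesis
    using assms by (simp add: rank_def)
qed

section \<open>The statistic \<open>s_stat\<close> as a sum of ranks\<close>

lemma block_end_psum:
  assumes "\<gamma> \<in> comps n" "\<alpha> \<in> comps n" "i \<le> length \<gamma>" "psum \<gamma> i = psum \<alpha> j"
  shows "block_end \<alpha> \<gamma> j = i"
  unfolding block_end_def psum_def[symmetric]
proof (rule the_equality)
  show "k = i" if "k \<le> length \<gamma> \<and> psum \<gamma> k = psum \<alpha> j" for k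
    using psum_eq_iff[OF assms(1), of k i] that assms by simp
qed (use assms in simp)

text \<open>The cut points of \<gamma> strictly inside the \<open>j\<close>-th part of \<alpha> all
  have rank \<open>j\<close> with respect to the cuts of \<alpha>, and there are
  \<open>i_j - i_(j-1) - 1\<close> of them. Grouping the rank sum by \<open>j\<close> therefore
  gives the definition of \<open>s_stat\<close>.\<close>

lemma s_stat_eq:
  assumes g: "\<gamma> \<in> comps n" and a: "\<alpha> \<in> comps n" and sub: "proper_sums \<alpha> \<subseteq> proper_sums \<gamma>"
  shows "s_stat \<alpha> \<gamma> = (\<Sum>x\<in>proper_sums \<gamma> - proper_sums \<alpha>. rank (proper_sums \<alpha>) x)"
proof -
  \<comment> \<open>The total sums 0 and \<open>n\<close> are not proper sums, so they are matched
    separately; all others come from the inclusion. This makes every \<open>block_end\<close> a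
    genuine index into \<gamma>.\<close>
  have ex: "\<exists>i\<le>length \<gamma>. psum \<gamma> i = psum \<alpha> j" if j: "j \<le> length \<alpha>" for j
  proof -
    have "j = 0 \<or> j = length \<alpha> \<or> j \<in> {1..<length \<alpha>}"
      using j by auto
    then consider "j = 0" | "j = length \<alpha>" | "j \<in> {1..<length \<alpha>}"
      by blast
    then show ?thesis
    proof cases
      case 2
      then show ?thesis using psum_length[OF g] psum_length[OF a] by auto
    next
      case 3
      then have "psum \<alpha> j \<in> proper_sums \<gamma>"
        using sub by (auto simp: proper_sums_eq)
      then obtain i where "i < length \<gamma>" "psum \<alpha> j = psum \<gamma> i"
        by (auto simp: proper_sums_eq)
      then show ?thesis
        by (intro exI[of _ i]) simp
    qed auto
  qed
  let ?e = "block_end \<alpha> \<gamma>"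
  have e: "?e j \<le> length \<gamma>" "psum \<gamma> (?e j) = psum \<alpha> j" if "j \<le> length \<alpha>" for j
    using ex[OF that] block_end_psum[OF g a] by auto
  define B where "B = (\<lambda>j. {x \<in> proper_sums \<gamma>. psum \<alpha> (j - 1) < x \<and> x < psum \<alpha> j})"
  have card_B: "card (B j) = ?e j - ?e (j - 1) - 1" if j: "j \<in> {1..length \<alpha>}" for j
  proof -
    have ej: "?e j \<le> length \<gamma>" "psum \<gamma> (?e j) = psum \<alpha> j"
      and ej1: "?e (j - 1) \<le> length \<gamma>" "psum \<gamma> (?e (j - 1)) = psum \<alpha> (j - 1)"
      using e[of j] e[of "j - 1"] j by auto
    have "B j = psum \<gamma> ` {?e (j - 1)<..<?e j}"
    proof (intro equalityI subsetI)
      fix x assume "x \<in> B j"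
      then obtain i where i: "i < length \<gamma>" "x = psum \<gamma> i" "psum \<gamma> (?e (j - 1)) < psum \<gamma> i"
          "psum \<gamma> i < psum \<gamma> (?e j)"
        using ej ej1 by (auto simp: B_def proper_sums_eq)
      then have "?e (j - 1) < i" "i < ?e j"
        using psum_less_iff[OF g, of "?e (j - 1)" i] psum_less_iff[OF g, of i "?e j"] ej ej1 by auto
      then show "x \<in> psum \<gamma> ` {?e (j - 1)<..<?e j}"
        using i by auto
    next
      fix x assume "x \<in> psum \<gamma> ` {?e (j - 1)<..<?e j}"
      then obtain i where i: "?e (j - 1) < i" "i < ?e j" "x = psum \<gamma> i"
        by auto
      then show "x \<in> B j"
        using psum_less[OF g, of "?e (j - 1)" i] psum_less[OF g, of i "?e j"] ej ej1
        by (auto simp: B_def proper_sums_eq)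
    qed
    moreover have "inj_on (psum \<gamma>) {?e (j - 1)<..<?e j}"
      using ej by (intro inj_on_subset[OF inj_on_psum[OF g]]) auto
    ultimately show ?thesis
      by (simp add: card_image)
  qed
  have rank_B: "rank (proper_sums \<alpha>) x = j" if "j \<in> {1..length \<alpha>}" "x \<in> B j" for x j
    using that rank_proper_sums[OF a, of "j - 1" x] by (auto simp: B_def)
  have Un: "proper_sums \<gamma> - proper_sums \<alpha> = (\<Union>j\<in>{1..length \<alpha>}. B j)"
  proof (intro equalityI subsetI)
    fix x assume x: "x \<in> proper_sums \<gamma> - proper_sums \<alpha>"
    then have xn: "x \<in> {1..<n}"
      using proper_sums_subset[OF g] by auto
    obtain j where j: "j < length \<alpha>" "psum \<alpha> j < x" "x \<le> psum \<alpha> (Suc j)"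
      using psum_interval[OF a, of x] xn by auto
    \<comment> \<open>The right end of a part of \<alpha> is either a proper sum of \<alpha> or
      equal to \<open>n\<close>, and \<open>x\<close> is neither.\<close>
    have "x \<noteq> psum \<alpha> (Suc j)"
    proof
      assume eq: "x = psum \<alpha> (Suc j)"
      then have "Suc j \<noteq> length \<alpha>"
        using psum_length[OF a] xn by auto
      then show False
        using x eq j by (auto simp: proper_sums_eq)
    qed
    then show "x \<in> (\<Union>j\<in>{1..length \<alpha>}. B j)"
      using x j by (intro UN_I[of "Suc j"]) (auto simp: B_def)
  next
    fix x assume "x \<in> (\<Union>j\<in>{1..length \<alpha>}. B j)"
    then obtain j where j: "j \<in> {1..length \<alpha>}" "x \<in> B j"
      by blast
    have "x \<notin> proper_sums \<alpha>"
    proof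
      assume "x \<in> proper_sums \<alpha>"
      then obtain i where i: "i < length \<alpha>" "x = psum \<alpha> i"
        by (auto simp: proper_sums_eq)
      then have "j - 1 < i" "i < j"
        using j psum_less_iff[OF a, of "j - 1" i] psum_less_iff[OF a, of i j] by (auto simp: B_def)
      then show False by simp
    qed
    then show "x \<in> proper_sums \<gamma> - proper_sums \<alpha>"
      using j by (simp add: B_def)
  qed
  have "(\<Sum>x\<in>proper_sums \<gamma> - proper_sums \<alpha>. rank (proper_sums \<alpha>) x) =
      (\<Sum>j\<in>{1..length \<alpha>}. \<Sum>x\<in>B j. rank (proper_sums \<alpha>) x)"
    unfolding Un
  proof (rule sum.UNION_disjoint)
    show "\<forall>i\<in>{1..length \<alpha>}. \<forall>j\<in>{1..length \<alpha>}. i \<noteq> j \<longrightarrow> B i \<inter> B j = {}"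
      using rank_B by blast
  qed (auto simp: B_def)
  also have "\<dots> = (\<Sum>j\<in>{1..length \<alpha>}. j * card (B j))"
    by (intro sum.cong refl) (simp add: rank_B)
  also have "\<dots> = s_stat \<alpha> \<gamma>"
    unfolding s_stat_def by (intro sum.cong refl) (simp add: card_B)
  finally show ?thesis ..
qed

section \<open>Standardization\<close>

lemma diagram_eq_Sigma: "diagram \<alpha> = (SIGMA i:{1..length \<alpha>}. {1..part \<alpha> i})"
  by (auto simp: diagram_def)

lemma finite_diagram [simp]: "finite (diagram \<alpha>)"
  by (simp add: diagram_eq_Sigma)

lemma card_diagram: "card (diagram \<alpha>) = sum_list \<alpha>"
proof -
  have "card (diagram \<alpha>) = (\<Sum>i\<in>{1..length \<alpha>}. part \<alpha> i)"
    by (simp add: diagram_eq_Sigma)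
  also have "\<dots> = (\<Sum>i\<in>{0..<length \<alpha>}. \<alpha> ! i)"
    by (rule sum.reindex_bij_witness[of _ Suc "\<lambda>i. i - 1"]) (auto simp: part_def)
  finally show ?thesis
    by (simp add: sum_list_sum_nth)
qed

text \<open>In column 1 the entries increase strictly. Elsewhere, if two entries of a column agreed,
  the first alternative of the triple rule would fail outright, and the second would contradict the
  weak decrease of the row containing the neighbouring cell.\<close>

lemma ssct_column_distinct:
  assumes T: "ssct \<alpha> T" and "(i, k) \<in> diagram \<alpha>" "(j, k) \<in> diagram \<alpha>" "i \<noteq> j"
  shows "T (i, k) \<noteq> T (j, k)"
proof -
  have *: "T (i, k) \<noteq> T (j, k)"
    if ij: "i < j" and i: "(i, k) \<in> diagram \<alpha>" and j: "(j, k) \<in> diagram \<alpha>" for i j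
  proof -
    have row: "T (r, b) \<le> T (r, a)" if "a < b" "(r, a) \<in> diagram \<alpha>" "(r, b) \<in> diagram \<alpha>" for r a b
      using T that unfolding ssct_def by blast
    have triple: "if part \<alpha> i \<ge> part \<alpha> j
         then k > 1 \<longrightarrow> T (j, k) < T (i, k) \<or> T (i, k - 1) < T (j, k)
         else T (j, k) < T (i, k) \<or> T (i, k) < T (j, k + 1)"
      using T ij i j unfolding ssct_def by blast
    consider "k = 1" | "k > 1" "part \<alpha> i \<ge> part \<alpha> j" | "part \<alpha> i < part \<alpha> j"
      using i by (fastforce simp: diagram_def)
    then show ?thesis
    proof cases
      case 1
      then show ?thesis
        using T ij i j unfolding ssct_def by (metis less_irrefl)
    next
      case 2
      then have "T (i, k) \<le> T (i, k - 1)"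
        using i by (intro row) (auto simp: diagram_def)
      then show ?thesis using triple 2 by auto
    next
      case 3
      then have "T (j, k + 1) \<le> T (j, k)"
        using i j by (intro row) (auto simp: diagram_def)
      then show ?thesis using triple 3 by auto
    qed
  qed
  show ?thesis
    using *[of i j] *[of j i] assms by (metis nat_neq_iff)
qed

text \<open>Every strict inequality demanded of a tableau compares a smaller entry with a larger one
  lying weakly to its right. Standardization and its inverse preserve exactly these.\<close>

lemma ssct_transfer:
  assumes T: "ssct \<alpha> T" and U: "U \<in> diagram \<alpha> \<rightarrow>\<^sub>E {1..}"
    and less: "\<And>c d. c \<in> diagram \<alpha> \<Longrightarrow> d \<in> diagram \<alpha> \<Longrightarrow> T c < T d \<Longrightarrow> snd c \<le> snd d \<Longrightarrow> U c < U d"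
    and le: "\<And>c d. c \<in> diagram \<alpha> \<Longrightarrow> d \<in> diagram \<alpha> \<Longrightarrow> T d \<le> T c \<Longrightarrow> snd c < snd d \<Longrightarrow> U d \<le> U c"
  shows "ssct \<alpha> U"
  unfolding ssct_def
proof (intro conjI allI impI U)
  fix i j k assume *: "j < k \<and> (i, j) \<in> diagram \<alpha> \<and> (i, k) \<in> diagram \<alpha>"
  then have "T (i, k) \<le> T (i, j)"
    using T unfolding ssct_def by blast
  then show "U (i, k) \<le> U (i, j)"
    using * by (intro le) auto
next
  fix i j assume *: "i < j \<and> (i, 1) \<in> diagram \<alpha> \<and> (j, 1) \<in> diagram \<alpha>"
  then have "T (i, 1) < T (j, 1)"
    using T unfolding ssct_def by blast
  then show "U (i, 1) < U (j, 1)"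
    using * by (intro less) auto
next
  fix i j k assume *: "i < j \<and> (i, k) \<in> diagram \<alpha> \<and> (j, k) \<in> diagram \<alpha>"
  have triple: "if part \<alpha> i \<ge> part \<alpha> j
         then k > 1 \<longrightarrow> T (j, k) < T (i, k) \<or> T (i, k - 1) < T (j, k)
         else T (j, k) < T (i, k) \<or> T (i, k) < T (j, k + 1)"
    using T * unfolding ssct_def by blast
  have 1: "(i, k - 1) \<in> diagram \<alpha>" if "k > 1"
    using that * by (auto simp: diagram_def)
  have 2: "(j, k + 1) \<in> diagram \<alpha>" if "part \<alpha> i < part \<alpha> j"
    using that * by (auto simp: diagram_def)
  show "if part \<alpha> i \<ge> part \<alpha> j
         then k > 1 \<longrightarrow> U (j, k) < U (i, k) \<or> U (i, k - 1) < U (j, k)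
         else U (j, k) < U (i, k) \<or> U (i, k) < U (j, k + 1)"
  proof (cases "part \<alpha> i \<ge> part \<alpha> j")
    case True
    then show ?thesis
      using triple * 1 less[of "(j, k)" "(i, k)"] less[of "(i, k - 1)" "(j, k)"] by auto
  next
    case False
    then show ?thesis
      using triple * 2 less[of "(j, k)" "(i, k)"] less[of "(i, k)" "(j, k + 1)"] by auto
  qed
qed

section \<open>Standard tableaux and their descents\<close>

definition standard :: "nat list \<Rightarrow> (nat \<times> nat \<Rightarrow> nat) set" where
  "standard \<alpha> = {S. ssct \<alpha> S \<and> bij_betw S (diagram \<alpha>) {1..sum_list \<alpha>}}"

definition cell :: "nat list \<Rightarrow> (nat \<times> nat \<Rightarrow> nat) \<Rightarrow> nat \<Rightarrow> nat \<times> nat" where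
  "cell \<alpha> S p = inv_into (diagram \<alpha>) S p"

definition Des :: "nat list \<Rightarrow> (nat \<times> nat \<Rightarrow> nat) \<Rightarrow> nat set" where
  "Des \<alpha> S = {p \<in> {1..<sum_list \<alpha>}. snd (cell \<alpha> S p) \<le> snd (cell \<alpha> S (Suc p))}"

lemma cell_in:
  assumes "S \<in> standard \<alpha>" "p \<in> {1..sum_list \<alpha>}"
  shows "cell \<alpha> S p \<in> diagram \<alpha>" "S (cell \<alpha> S p) = p"
proof -
  have "S ` diagram \<alpha> = {1..sum_list \<alpha>}"
    using assms(1) by (simp add: standard_def bij_betw_def)
  then show "cell \<alpha> S p \<in> diagram \<alpha>" "S (cell \<alpha> S p) = p"
    using assms(2) by (auto simp: cell_def intro: inv_into_into f_inv_into_f)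
qed

lemma standard_in: "S \<in> standard \<alpha> \<Longrightarrow> c \<in> diagram \<alpha> \<Longrightarrow> S c \<in> {1..sum_list \<alpha>}"
  by (auto simp: standard_def bij_betw_def)

lemma cell_standard: "S \<in> standard \<alpha> \<Longrightarrow> c \<in> diagram \<alpha> \<Longrightarrow> cell \<alpha> S (S c) = c"
  by (auto simp: standard_def bij_betw_def cell_def)

section \<open>The reading order and the standardization of a tableau\<close>

text \<open>The reading order in its weak form: by entry, ties from right to left. It is a total
  preorder for every filling; on a tableau it is antisymmetric because a tie within one column
  cannot occur.\<close>

definition before :: "('a \<times> nat \<Rightarrow> nat) \<Rightarrow> 'a \<times> nat \<Rightarrow> 'a \<times> nat \<Rightarrow> bool" where
  "before T c d \<longleftrightarrow> T c < T d \<or> (T c = T d \<and> snd d \<le> snd c)"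

lemma before_refl: "before T c c"
  by (simp add: before_def)

lemma before_trans: "before T c d \<Longrightarrow> before T d e \<Longrightarrow> before T c e"
  by (auto simp: before_def)

lemma before_total: "before T c d \<or> before T d c"
  by (auto simp: before_def)

lemma before_antisym:
  assumes "ssct \<alpha> T" "c \<in> diagram \<alpha>" "d \<in> diagram \<alpha>" "before T c d" "before T d c"
  shows "c = d"
proof -
  have "T c = T d" "snd c = snd d"
    using assms(4,5) by (auto simp: before_def)
  then show ?thesis
    using ssct_column_distinct[OF assms(1), of "fst c" "snd c" "fst d"] assms(2,3)
    by (metis prod.collapse)
qed

text \<open>The position of a cell in the reading order; the cell counts itself, so positions start
  at 1.\<close>

definition std :: "nat list \<Rightarrow> (nat \<times> nat \<Rightarrow> nat) \<Rightarrow> nat \<times> nat \<Rightarrow> nat" where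
  "std \<alpha> T = restrict (\<lambda>c. card {d \<in> diagram \<alpha>. before T d c}) (diagram \<alpha>)"

text \<open>The down-sets of a total preorder are nested. If \<open>c\<close> is not before
  \<open>d\<close>, then the down-set of \<open>d\<close> is properly smaller, as it lacks
  \<open>c\<close>.\<close>

lemma std_le_iff:
  assumes "ssct \<alpha> T" "c \<in> diagram \<alpha>" "d \<in> diagram \<alpha>"
  shows "std \<alpha> T c \<le> std \<alpha> T d \<longleftrightarrow> before T c d"
proof
  assume "before T c d"
  then have "{e \<in> diagram \<alpha>. before T e c} \<subseteq> {e \<in> diagram \<alpha>. before T e d}"
    using before_trans by blast
  then show "std \<alpha> T c \<le> std \<alpha> T d"
    using assms by (auto simp: std_def intro: card_mono)
next
  assume le: "std \<alpha> T c \<le> std \<alpha> T d"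
  show "before T c d"
  proof (rule ccontr)
    assume n: "\<not> before T c d"
    then have "before T d c"
      using before_total by blast
    then have "{e \<in> diagram \<alpha>. before T e d} \<subset> {e \<in> diagram \<alpha>. before T e c}"
      using before_trans n assms(2) before_refl by blast
    then have "std \<alpha> T d < std \<alpha> T c"
      using assms by (auto simp: std_def intro: psubset_card_mono)
    then show False
      using le by simp
  qed
qed

text \<open>Antisymmetry of the reading order makes the positions distinct, and they range between 1
  and the number of cells, so they form a bijection. The tableau conditions carry over by
  \<open>ssct_transfer\<close>: a smaller entry is read earlier, and so is an equal entry further to
  the right.\<close>

lemma std_standard:
  assumes T: "ssct \<alpha> T"
  shows "std \<alpha> T \<in> standard \<alpha>"
proof -
  have pos: "std \<alpha> T c \<in> {1..sum_list \<alpha>}" if c: "c \<in> diagram \<alpha>" for c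
  proof -
    have "c \<in> {d \<in> diagram \<alpha>. before T d c}"
      using c before_refl by blast
    moreover have "finite {d \<in> diagram \<alpha>. before T d c}"
      by simp
    ultimately have "0 < card {d \<in> diagram \<alpha>. before T d c}"
      by (metis card_gt_0_iff empty_iff)
    moreover have "card {d \<in> diagram \<alpha>. before T d c} \<le> card (diagram \<alpha>)"
      by (intro card_mono) auto
    ultimately show ?thesis
      using c by (simp add: std_def card_diagram)
  qed
  have "inj_on (std \<alpha> T) (diagram \<alpha>)"
    using before_antisym[OF T] std_le_iff[OF T] by (intro inj_onI) (metis order_refl)
  then have bij: "bij_betw (std \<alpha> T) (diagram \<alpha>) {1..sum_list \<alpha>}"
    using pos by (intro bij_betw_imageI card_subset_eq) (auto simp: card_image card_diagram)
  have "ssct \<alpha> (std \<alpha> T)"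
  proof (rule ssct_transfer[OF T])
    show "std \<alpha> T \<in> diagram \<alpha> \<rightarrow>\<^sub>E {1..}"
      using pos by (auto simp: std_def)
    show "std \<alpha> T c < std \<alpha> T d" if "c \<in> diagram \<alpha>" "d \<in> diagram \<alpha>" "T c < T d" for c d
      using std_le_iff[OF T that(2,1)] that(3) by (auto simp: before_def)
    show "std \<alpha> T d \<le> std \<alpha> T c"
      if "c \<in> diagram \<alpha>" "d \<in> diagram \<alpha>" "T d \<le> T c" "snd c < snd d" for c d
      using std_le_iff[OF T that(2,1)] that(3,4) by (auto simp: before_def)
  qed
  then show ?thesis
    using bij by (simp add: standard_def)
qed

section \<open>Relabelling a standard tableau\<close>

text \<open>\<open>f p\<close> is the entry for the cell numbered \<open>p\<close>. On positions 1
  to \<open>n\<close> these are the words summed in the fundamental polynomial of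
  \<open>Des \<alpha> S\<close>, but with no upper bound on the letters.\<close>

definition compatible :: "nat list \<Rightarrow> (nat \<times> nat \<Rightarrow> nat) \<Rightarrow> (nat \<Rightarrow> nat) \<Rightarrow> bool" where
  "compatible \<alpha> S f \<longleftrightarrow> (\<forall>p\<in>{1..sum_list \<alpha>}. 1 \<le> f p) \<and>
     (\<forall>p\<in>{1..<sum_list \<alpha>}. f p \<le> f (Suc p) \<and> (p \<in> Des \<alpha> S \<longrightarrow> f p < f (Suc p)))"

definition relabel :: "nat list \<Rightarrow> (nat \<Rightarrow> nat) \<Rightarrow> (nat \<times> nat \<Rightarrow> nat) \<Rightarrow> nat \<times> nat \<Rightarrow> nat" where
  "relabel \<alpha> f S = restrict (\<lambda>c. f (S c)) (diagram \<alpha>)"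

text \<open>A stretch of equal labels contains no descent, so each step along it moves strictly to
  the left.\<close>

lemma compatible_less:
  assumes "compatible \<alpha> S f" "1 \<le> p" "p < q" "q \<le> sum_list \<alpha>"
  shows "f p < f q \<or> (f p = f q \<and> snd (cell \<alpha> S q) < snd (cell \<alpha> S p))"
  using assms(3,4)
proof (induction q)
  case (Suc q)
  have q: "q \<in> {1..<sum_list \<alpha>}"
    using Suc.prems assms(2) by auto
  have step: "f q < f (Suc q) \<or> (f q = f (Suc q) \<and> snd (cell \<alpha> S (Suc q)) < snd (cell \<alpha> S q))"
    using assms(1) q unfolding compatible_def Des_def by fastforce
  show ?case
    using step Suc by (cases "p = q") auto
qed simp

text \<open>Labels increase weakly with the numbering, and by \<open>compatible_less\<close> equal
  labels are numbered from right to left. So the reading order of the relabelled filling is the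
  numbering by \<open>S\<close>; both \<open>ssct_relabel\<close> and \<open>std_relabel\<close>
  rest on this.\<close>

lemma before_relabel_iff:
  assumes S: "S \<in> standard \<alpha>" and f: "compatible \<alpha> S f"
    and c: "c \<in> diagram \<alpha>" and d: "d \<in> diagram \<alpha>"
  shows "before (relabel \<alpha> f S) c d \<longleftrightarrow> S c \<le> S d"
proof -
  have less: "f (S c) < f (S d) \<or> (f (S c) = f (S d) \<and> snd d < snd c)"
    if "S c < S d" "c \<in> diagram \<alpha>" "d \<in> diagram \<alpha>" for c d
    using compatible_less[OF f, of "S c" "S d"] standard_in[OF S] cell_standard[OF S] that by auto
  have eq: "S c = S d \<Longrightarrow> c = d"
    using cell_standard[OF S] c d by metis
  show ?thesis
    using less[of c d] less[of d c] eq c d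
    by (cases "S c" "S d" rule: linorder_cases) (auto simp: before_def relabel_def)
qed

lemma ssct_relabel:
  assumes S: "S \<in> standard \<alpha>" and f: "compatible \<alpha> S f"
  shows "ssct \<alpha> (relabel \<alpha> f S)"
proof (rule ssct_transfer)
  show "ssct \<alpha> S"
    using S by (simp add: standard_def)
  show "relabel \<alpha> f S \<in> diagram \<alpha> \<rightarrow>\<^sub>E {1..}"
    using standard_in[OF S] f by (auto simp: relabel_def compatible_def)
  show "relabel \<alpha> f S c < relabel \<alpha> f S d"
    if "c \<in> diagram \<alpha>" "d \<in> diagram \<alpha>" "S c < S d" "snd c \<le> snd d" for c d
    using before_relabel_iff[OF S f that(2,1)] that by (auto simp: before_def)
  show "relabel \<alpha> f S d \<le> relabel \<alpha> f S c"
    if "c \<in> diagram \<alpha>" "d \<in> diagram \<alpha>" "S d \<le> S c" for c d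
    using before_relabel_iff[OF S f that(2,1)] that by (auto simp: before_def)
qed

lemma standard_restrict: "S \<in> standard \<alpha> \<Longrightarrow> restrict S (diagram \<alpha>) = S"
  by (auto simp: standard_def ssct_def)

lemma std_relabel:
  assumes S: "S \<in> standard \<alpha>" and f: "compatible \<alpha> S f"
  shows "std \<alpha> (relabel \<alpha> f S) = S"
proof -
  have "card {d \<in> diagram \<alpha>. before (relabel \<alpha> f S) d c} = S c" if c: "c \<in> diagram \<alpha>" for c
  proof -
    have "{d \<in> diagram \<alpha>. before (relabel \<alpha> f S) d c} = {d \<in> diagram \<alpha>. S d \<le> S c}"
      using before_relabel_iff[OF S f] c by blast
    \<comment> \<open>The cells numbered up to \<open>S c\<close> are enumerated without repetition
      by \<open>cell\<close>, so there are exactly \<open>S c\<close> of them.\<close>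
    also have "\<dots> = cell \<alpha> S ` {1..S c}"
    proof (intro equalityI subsetI)
      fix d assume "d \<in> {d \<in> diagram \<alpha>. S d \<le> S c}"
      then show "d \<in> cell \<alpha> S ` {1..S c}"
        using standard_in[OF S, of d] cell_standard[OF S, of d] by (intro image_eqI[of _ _ "S d"]) auto
    next
      fix d assume "d \<in> cell \<alpha> S ` {1..S c}"
      then show "d \<in> {d \<in> diagram \<alpha>. S d \<le> S c}"
        using standard_in[OF S c] cell_in[OF S] by auto
    qed
    also have "card \<dots> = card {1..S c}"
    proof (rule card_image)
      show "inj_on (cell \<alpha> S) {1..S c}"
        using standard_in[OF S c] cell_in(2)[OF S] by (intro inj_onI) (metis atLeastAtMost_iff order_trans)
    qed
    finally show ?thesis by simp
  qed
  then have "std \<alpha> (relabel \<alpha> f S) = restrict S (diagram \<alpha>)"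
    unfolding std_def by (intro restrict_ext) auto
  then show ?thesis
    by (simp add: standard_restrict[OF S])
qed

text \<open>Entries increase weakly along the reading order. If the cells of \<open>p\<close> and
  \<open>p + 1\<close> carry equal entries, the second lies strictly to the left, so
  \<open>p\<close> is not a descent.\<close>

lemma compatible_std:
  assumes T: "ssct \<alpha> T"
  shows "compatible \<alpha> (std \<alpha> T) (\<lambda>p. T (cell \<alpha> (std \<alpha> T) p))"
  unfolding compatible_def
proof (intro conjI ballI impI)
  let ?S = "std \<alpha> T"
  note S = std_standard[OF T]
  fix p assume p: "p \<in> {1..sum_list \<alpha>}"
  have "T \<in> diagram \<alpha> \<rightarrow>\<^sub>E {1..}"
    using T by (simp add: ssct_def)
  then show "1 \<le> T (cell \<alpha> ?S p)"
    using cell_in(1)[OF S p] by (auto simp: PiE_iff)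
next
  let ?S = "std \<alpha> T"
  note S = std_standard[OF T]
  fix p assume p: "p \<in> {1..<sum_list \<alpha>}"
  let ?c = "cell \<alpha> ?S p" and ?d = "cell \<alpha> ?S (Suc p)"
  have c: "?c \<in> diagram \<alpha>" "?S ?c = p" and d: "?d \<in> diagram \<alpha>" "?S ?d = Suc p"
    using cell_in[OF S] p by auto
  have b: "before T ?c ?d"
    using std_le_iff[OF T c(1) d(1)] c(2) d(2) by simp
  then show "T ?c \<le> T ?d"
    by (auto simp: before_def)
  assume "p \<in> Des \<alpha> ?S"
  then have "snd ?c \<le> snd ?d"
    by (simp add: Des_def)
  moreover have "\<not> before T ?d ?c"
    using std_le_iff[OF T d(1) c(1)] c(2) d(2) by simp
  ultimately show "T ?c < T ?d"
    using b by (auto simp: before_def)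
qed

lemma relabel_std:
  assumes T: "ssct \<alpha> T"
  shows "relabel \<alpha> (\<lambda>p. T (cell \<alpha> (std \<alpha> T) p)) (std \<alpha> T) = T"
proof -
  have "relabel \<alpha> (\<lambda>p. T (cell \<alpha> (std \<alpha> T) p)) (std \<alpha> T) = restrict T (diagram \<alpha>)"
    unfolding relabel_def using cell_standard[OF std_standard[OF T]] by (intro restrict_ext) auto
  also have "\<dots> = T"
    using T unfolding ssct_def by (meson PiE_restrict)
  finally show ?thesis .
qed

section \<open>Polynomials indexed by subsets\<close>

lemma const_simps: "const 0 = 0" "const 1 = 1" "const (a + b) = const a + const b"
  "const (a * b) = const a * const b" "const (a - b) = const a - const b"
  by (simp_all add: const_def single_add mult_single single_diff)

lemma const_sum: "const (sum f I) = (\<Sum>i\<in>I. const (f i))"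
  by (induction I rule: infinite_finite_induct) (simp_all add: const_simps)

lemma lookup_const_mult: "poly_mapping.lookup (const c * f) m = c * poly_mapping.lookup f m"
  by (simp add: const_def mult_map_scale_conv_mult[symmetric] Poly_Mapping.map.rep_eq when_def)

definition words :: "nat \<Rightarrow> nat \<Rightarrow> nat set \<Rightarrow> nat list set" where
  "words N n A = {w. length w = n \<and> set w \<subseteq> {1..N} \<and> sorted w \<and> (\<forall>j\<in>A. w ! (j - 1) < w ! j)}"

lemma finite_words [simp]: "finite (words N n A)"
  by (rule finite_subset[OF _ finite_lists_length_eq[of "{1..N}" n]]) (auto simp: words_def)

definition fundamental_of :: "nat \<Rightarrow> nat \<Rightarrow> nat set \<Rightarrow> xpoly" where
  "fundamental_of N n A = (\<Sum>w\<in>words N n A. prod_list (map X w))"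

text \<open>\<open>hivert_G\<close> for the composition with cut set \<open>C\<close>. The interval
  is one of sets under inclusion and runs over the cut sets of refinements; the rank sum is
  \<open>s_stat\<close> by \<open>s_stat_eq\<close>.\<close>

definition hivert_of :: "nat \<Rightarrow> nat \<Rightarrow> nat set \<Rightarrow> xpoly" where
  "hivert_of N n C = (\<Sum>B\<in>{C..{1..<n}}.
     const ((- 1) ^ card (B - C) * t ^ (\<Sum>x\<in>B - C. rank C x)) * fundamental_of N n B)"

lemma finite_set_interval [simp]: "finite B \<Longrightarrow> finite {A..B::'a set}"
  by (rule finite_subset[of _ "Pow B"]) (auto simp only: atLeastAtMost_iff)

lemma fundamental_eq_fundamental_of:
  "\<gamma> \<in> comps n \<Longrightarrow> fundamental N \<gamma> = fundamental_of N n (proper_sums \<gamma>)"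
  by (simp add: fundamental_def fundamental_of_def words_def comps_def)

lemma hivert_G_eq_hivert_of:
  assumes a: "\<alpha> \<in> comps n"
  shows "hivert_G N \<alpha> = hivert_of N n (proper_sums \<alpha>)"
proof -
  let ?P = proper_sums
  let ?h = "\<lambda>B. const ((- 1) ^ card (B - ?P \<alpha>) * t ^ (\<Sum>x\<in>B - ?P \<alpha>. rank (?P \<alpha>) x)) * fundamental_of N n B"
  let ?I = "{\<gamma> \<in> comps n. ?P \<alpha> \<subseteq> ?P \<gamma>}"
  have bij: "bij_betw ?P ?I {?P \<alpha>..{1..<n}}"
  proof (rule bij_betw_imageI)
    show "inj_on ?P ?I"
      by (rule inj_on_subset[OF inj_on_proper_sums]) auto
    have "?P ` comps n = Pow {1..<n}"
      using bij_betw_proper_sums by (simp add: bij_betw_def)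
    moreover have "?P ` ?I = {B \<in> ?P ` comps n. ?P \<alpha> \<subseteq> B}"
      by blast
    ultimately show "?P ` ?I = {?P \<alpha>..{1..<n}}"
      by (simp only:) fastforce
  qed
  have n: "sum_list \<alpha> = n"
    using a by (simp add: comps_def)
  have "hivert_G N \<alpha> = (\<Sum>\<gamma>\<in>?I. ?h (?P \<gamma>))"
    unfolding hivert_G_def n using refines_iff[OF _ a]
    by (intro sum.cong) (auto simp: length_diff_eq[OF _ a] s_stat_eq[OF _ a] fundamental_eq_fundamental_of)
  also have "\<dots> = hivert_of N n (?P \<alpha>)"
    unfolding hivert_of_def by (rule sum.reindex_bij_betw[OF bij])
  finally show ?thesis .
qed

text \<open>For \<open>A \<noteq> B\<close>, toggling the largest element of \<open>B - A\<close> in \<open>C\<close> changes no rank of an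
  element of \<open>B - A\<close>, so the terms cancel in pairs.\<close>

lemma signed_rank_sum:
  assumes "finite B" "A \<subseteq> B"
  shows "(\<Sum>C\<in>{A..B}. (- 1) ^ card (B - C) * t ^ (\<Sum>x\<in>B - A. rank C x)) = (if A = B then 1 else 0)"
proof (cases "A = B")
  case False
  then have ne: "B - A \<noteq> {}"
    using assms(2) by blast
  have fin: "finite (B - A)"
    using assms(1) by simp
  define x where "x = Max (B - A)"
  have x: "x \<in> B - A"
    using Max_in[OF fin ne] by (simp add: x_def)
  have le: "y \<le> x" if "y \<in> B - A" for y
    using Max_ge[OF fin that] by (simp add: x_def)
  define tog where "tog = (\<lambda>C. if x \<in> C then C - {x} else insert x C)"
  have rank: "rank (tog C) y = rank C y" if "y \<in> B - A" for C y
  proof -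
    have "{z \<in> tog C. z < y} = {z \<in> C. z < y}"
      using le[OF that] by (auto simp: tog_def)
    then show ?thesis
      by (simp add: rank_def)
  qed
  have sign: "(- 1) ^ card (B - tog C) = - ((- 1) ^ card (B - C) :: int poly)" if C: "C \<in> {A..B}" for C
  proof (cases "x \<in> C")
    case True
    then have "B - tog C = insert x (B - C)"
      using x by (auto simp: tog_def)
    then show ?thesis
      using True assms(1) by simp
  next
    case False
    then have "B - C = insert x (B - tog C)" "x \<notin> B - tog C"
      using x by (auto simp: tog_def)
    then show ?thesis
      using assms(1) by simp
  qed
  let ?h = "\<lambda>C. (- 1) ^ card (B - C) * t ^ (\<Sum>x\<in>B - A. rank C x) :: int poly"
  have "sum ?h {A..B} = (\<Sum>C\<in>{A..B}. - ?h C)"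
  proof (rule sum.reindex_bij_witness[of _ tog tog])
    show "- ?h (tog C) = ?h C" if "C \<in> {A..B}" for C
      using sign[OF that] rank by simp
  qed (use x in \<open>auto simp: tog_def\<close>)
  then have "sum ?h {A..B} = 0"
    by (simp add: sum_negf)
  then show ?thesis
    using False by simp
qed (simp add: atLeastAtMost_singleton)

text \<open>Inserting the definition of \<open>hivert_of\<close> and exchanging the sums leaves, in
  front of each \<open>fundamental_of N n B\<close>, the alternating sum over \<open>{A..B}\<close>
  that \<open>signed_rank_sum\<close> evaluates. Only \<open>B = A\<close> survives.\<close>

lemma fundamental_of_eq_sum_hivert_of:
  assumes A: "A \<subseteq> {1..<n}"
  shows "fundamental_of N n A = (\<Sum>C\<in>{A..{1..<n}}. const (t ^ (\<Sum>x\<in>C - A. rank C x)) * hivert_of N n C)"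
proof -
  let ?U = "{1..<n}"
  let ?h = "\<lambda>B C. (- 1) ^ card (B - C) * t ^ (\<Sum>x\<in>B - A. rank C x) :: int poly"
  have "(\<Sum>C\<in>{A..?U}. const (t ^ (\<Sum>x\<in>C - A. rank C x)) * hivert_of N n C) =
      (\<Sum>C\<in>{A..?U}. \<Sum>B\<in>{C..?U}. const (?h B C) * fundamental_of N n B)"
  proof (rule sum.cong[OF refl])
    fix C assume C: "C \<in> {A..?U}"
    \<comment> \<open>Both exponents take ranks with respect to the same set \<open>C\<close>, so
      they add up to one sum over the disjoint union \<open>B - A\<close>.\<close>
    have "t ^ (\<Sum>x\<in>C - A. rank C x) * (- 1) ^ card (B - C) * t ^ (\<Sum>x\<in>B - C. rank C x) = ?h B C"
      if B: "B \<in> {C..?U}" for B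
    proof -
      have fin: "finite B" "finite C"
        using B C by (meson atLeastAtMost_iff finite_atLeastLessThan finite_subset)+
      have "B - A = (C - A) \<union> (B - C)"
        using B C by auto
      then have "(\<Sum>x\<in>B - A. rank C x) = (\<Sum>x\<in>C - A. rank C x) + (\<Sum>x\<in>B - C. rank C x)"
        using fin by (simp only:) (rule sum.union_disjoint, auto)
      then show ?thesis
        by (simp add: power_add)
    qed
    then show "const (t ^ (\<Sum>x\<in>C - A. rank C x)) * hivert_of N n C = (\<Sum>B\<in>{C..?U}. const (?h B C) * fundamental_of N n B)"
      unfolding hivert_of_def sum_distrib_left mult.assoc[symmetric] const_simps(4)[symmetric]
      by (intro sum.cong refl) (simp only:)
  qed
  also have "\<dots> = (\<Sum>C\<in>{A..?U}. \<Sum>B | B \<in> {A..?U} \<and> C \<subseteq> B. const (?h B C) * fundamental_of N n B)"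
    by (intro sum.cong refl set_eqI) (simp only: atLeastAtMost_iff mem_Collect_eq, blast)
  also have "\<dots> = (\<Sum>B\<in>{A..?U}. \<Sum>C | C \<in> {A..?U} \<and> C \<subseteq> B. const (?h B C) * fundamental_of N n B)"
    by (intro sum.swap_restrict) simp_all
  also have "\<dots> = (\<Sum>B\<in>{A..?U}. \<Sum>C\<in>{A..B}. const (?h B C) * fundamental_of N n B)"
    by (intro sum.cong refl set_eqI) (simp only: atLeastAtMost_iff mem_Collect_eq, blast)
  also have "\<dots> = (\<Sum>B\<in>{A..?U}. const (\<Sum>C\<in>{A..B}. ?h B C) * fundamental_of N n B)"
    by (simp only: const_sum sum_distrib_right)
  also have "\<dots> = (\<Sum>B\<in>{A..?U}. if B = A then fundamental_of N n B else 0)"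
  proof (intro sum.cong refl)
    fix B assume "B \<in> {A..?U}"
    then have "finite B" "A \<subseteq> B"
      by (meson atLeastAtMost_iff finite_atLeastLessThan finite_subset)+
    from signed_rank_sum[OF this]
    show "const (\<Sum>C\<in>{A..B}. ?h B C) * fundamental_of N n B = (if B = A then fundamental_of N n B else 0)"
      by (cases "A = B") (simp_all add: const_simps)
  qed
  also have "\<dots> = fundamental_of N n A"
    using A by simp
  finally show ?thesis ..
qed

section \<open>Linear independence\<close>

definition monomial :: "nat list \<Rightarrow> nat \<Rightarrow>\<^sub>0 nat" where
  "monomial w = sum_list (map (\<lambda>i. Poly_Mapping.single i 1) w)"

lemma prod_list_X: "prod_list (map X w) = Poly_Mapping.single (monomial w) 1"
  by (induction w) (simp_all add: X_def monomial_def mult_single)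

lemma lookup_monomial: "poly_mapping.lookup (monomial w) i = count_list w i"
  by (induction w) (auto simp: monomial_def lookup_add lookup_single)

lemma sorted_monomial_inject:
  assumes "sorted v" "sorted w" "monomial v = monomial w"
  shows "v = w"
proof -
  have "count_list v i = count_list w i" for i
    using assms(3) by (metis lookup_monomial)
  then have "mset v = mset w"
    by (intro multiset_eqI) (simp add: count_mset)
  then show ?thesis
    using assms(1,2) by (metis properties_for_sort)
qed

text \<open>A sorted word is determined by its letter counts, so different words contribute
  different monomials.\<close>

lemma lookup_fundamental_of:
  assumes "sorted w"
  shows "poly_mapping.lookup (fundamental_of N n A) (monomial w) = (if w \<in> words N n A then 1 else 0)"
proof -
  have "poly_mapping.lookup (fundamental_of N n A) (monomial w) =
      (\<Sum>v\<in>words N n A. poly_mapping.lookup (Poly_Mapping.single (monomial v) 1) (monomial w))"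
    by (simp add: fundamental_of_def lookup_sum prod_list_X)
  also have "\<dots> = (\<Sum>v\<in>words N n A. if v = w then 1 else 0)"
  proof (intro sum.cong refl)
    fix v assume "v \<in> words N n A"
    then have "sorted v"
      by (simp add: words_def)
    then show "poly_mapping.lookup (Poly_Mapping.single (monomial v) 1) (monomial w) = (if v = w then 1 else 0)"
      using sorted_monomial_inject[OF _ assms] by (auto simp: lookup_single when_def)
  qed
  finally show ?thesis
    by simp
qed

section \<open>Triangularity on test monomials\<close>

text \<open>The word \<open>1...12...2...\<close> whose letter multiplicities are the parts of the
  composition with cut set \<open>B\<close>.\<close>

definition rank_word :: "nat \<Rightarrow> nat set \<Rightarrow> nat list" where
  "rank_word n B = map (rank B) [1..<Suc n]"

lemma nth_rank_word: "i < n \<Longrightarrow> rank_word n B ! i = rank B (Suc i)"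
  by (simp add: rank_word_def del: upt_Suc)

lemma sorted_rank_word: "finite B \<Longrightarrow> sorted (rank_word n B)"
  by (auto simp: sorted_iff_nth_mono nth_rank_word rank_word_def rank_mono simp del: upt_Suc)

lemma rank_le:
  assumes "B \<subseteq> {1..<n}" "x \<in> {1..n}"
  shows "rank B x \<le> n"
proof -
  have "card {y \<in> B. y < x} \<le> card {1..<n}"
    using assms(1) by (intro card_mono) auto
  then show ?thesis
    using assms(2) unfolding rank_def by simp linarith
qed

text \<open>The word increases strictly exactly at the elements of \<open>B\<close>, so it satisfies
  the strictness required at \<open>A\<close> iff \<open>A\<close> lies in \<open>B\<close>. Its
  letters are at most \<open>n\<close>, and \<open>n \<le> N\<close> makes them admissible.\<close>

lemma rank_word_in_words_iff:
  assumes "A \<subseteq> {1..<n}" "B \<subseteq> {1..<n}" "n \<le> N"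
  shows "rank_word n B \<in> words N n A \<longleftrightarrow> A \<subseteq> B"
proof -
  have fin: "finite B"
    using assms(2) by (rule finite_subset) simp
  have "rank_word n B ! (j - 1) < rank_word n B ! j \<longleftrightarrow> j \<in> B" if "j \<in> A" for j
  proof -
    have "j \<in> {1..<n}"
      using that assms(1) by blast
    then show ?thesis
      using rank_less_Suc_iff[OF fin, of j] nth_rank_word[of "j - 1" n B] nth_rank_word[of j n B]
      by (simp add: less_imp_diff_less)
  qed
  moreover have "set (rank_word n B) \<subseteq> {1..N}"
    using rank_le[OF assms(2)] assms(3) rank_ge_1[of B] by (fastforce simp: rank_word_def)
  moreover have "length (rank_word n B) = n"
    by (simp add: rank_word_def)
  ultimately show ?thesis
    using sorted_rank_word[OF fin] by (auto simp: words_def)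
qed

text \<open>\<open>hivert_of N n C\<close> combines fundamental polynomials with cut sets
  \<open>E\<close> containing \<open>C\<close>, and such a polynomial has the test monomial of
  \<open>B\<close> only if \<open>E\<close> lies in \<open>B\<close>. No \<open>E\<close> remains
  unless \<open>C\<close> is contained in \<open>B\<close>; for \<open>C = B\<close> only
  \<open>E = B\<close> remains, with coefficient 1.\<close>

lemma lookup_hivert_of_rank_word:
  assumes "C \<subseteq> {1..<n}" "B \<subseteq> {1..<n}" "n \<le> N"
  shows "\<not> C \<subseteq> B \<Longrightarrow> poly_mapping.lookup (hivert_of N n C) (monomial (rank_word n B)) = 0"
    and "poly_mapping.lookup (hivert_of N n B) (monomial (rank_word n B)) = 1"
proof -
  have fin: "finite B"
    using assms(2) by (rule finite_subset) simp
  have iff: "rank_word n B \<in> words N n E \<longleftrightarrow> E \<subseteq> B" if "E \<in> {D..{1..<n}}" for D E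
    using that by (intro rank_word_in_words_iff assms) simp
  have *: "poly_mapping.lookup (hivert_of N n D) (monomial (rank_word n B)) =
      (\<Sum>E\<in>{D..{1..<n}}. (- 1) ^ card (E - D) * t ^ (\<Sum>x\<in>E - D. rank D x) *
         (if E \<subseteq> B then 1 else 0))" for D
    unfolding hivert_of_def lookup_sum
    by (intro sum.cong refl)
      (simp only: lookup_const_mult lookup_fundamental_of sorted_rank_word fin iff)
  show "poly_mapping.lookup (hivert_of N n C) (monomial (rank_word n B)) = 0" if "\<not> C \<subseteq> B"
  proof -
    have "\<not> E \<subseteq> B" if "E \<in> {C..{1..<n}}" for E
      using that \<open>\<not> C \<subseteq> B\<close> by auto
    then show ?thesis
      unfolding * by (intro sum.neutral) simp
  qed
  have "poly_mapping.lookup (hivert_of N n B) (monomial (rank_word n B)) =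
      (\<Sum>E\<in>{B..{1..<n}}. if E = B then 1 else 0)"
    unfolding * by (intro sum.cong refl) auto
  also have "\<dots> = 1"
    using assms(2) by simp
  finally show "poly_mapping.lookup (hivert_of N n B) (monomial (rank_word n B)) = 1" .
qed

text \<open>The system of test coefficients is unitriangular for inclusion. At the test monomial of
  \<open>B\<close>, proper subsets drop out by induction on the size and sets not contained in
  \<open>B\<close> have coefficient 0, which isolates \<open>c B\<close>.\<close>

lemma hivert_of_independent:
  assumes "n \<le> N" and zero: "(\<Sum>C\<in>Pow {1..<n}. const (c C) * hivert_of N n C) = 0"
    and "B \<subseteq> {1..<n}"
  shows "c B = 0"
  using assms(3)
proof (induction "card B" arbitrary: B rule: less_induct)
  case less
  let ?m = "monomial (rank_word n B)"
  have fin: "finite B"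
    using less.prems by (rule finite_subset) simp
  have "0 = poly_mapping.lookup (\<Sum>C\<in>Pow {1..<n}. const (c C) * hivert_of N n C) ?m"
    by (simp only: zero lookup_zero)
  also have "\<dots> = (\<Sum>C\<in>Pow {1..<n}. c C * poly_mapping.lookup (hivert_of N n C) ?m)"
    by (simp add: lookup_sum lookup_const_mult)
  also have "\<dots> = (\<Sum>C\<in>Pow {1..<n}. if C = B then c B else 0)"
  proof (intro sum.cong refl)
    fix C assume C: "C \<in> Pow {1..<n}"
    consider "C = B" | "C \<subset> B" | "\<not> C \<subseteq> B"
      by blast
    then show "c C * poly_mapping.lookup (hivert_of N n C) ?m = (if C = B then c B else 0)"
    proof cases
      case 1
      then show ?thesis
        using lookup_hivert_of_rank_word(2)[OF less.prems less.prems assms(1)] by simp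
    next
      case 2
      then show ?thesis
        using less.hyps[of C] C psubset_card_mono[OF fin] by auto
    next
      case 3
      then show ?thesis
        using lookup_hivert_of_rank_word(1)[OF _ less.prems assms(1), of C] C by auto
    qed
  qed
  also have "\<dots> = c B"
    using less.prems by simp
  finally show ?case ..
qed

lemma G_expansion_unique:
  assumes "n \<le> N" "G_expansion N n f a" "G_expansion N n f b"
  shows "a = b"
proof
  fix \<gamma>
  show "a \<gamma> = b \<gamma>"
  proof (cases "\<gamma> \<in> comps n")
    case True
    \<comment> \<open>\<open>g\<close> decodes a cut set into its composition, so that the
      difference of the two expansions can be indexed by sets.\<close>
    define g where "g = inv_into (comps n) proper_sums"
    define c where "c = (\<lambda>C. a (g C) - b (g C))"
    have g: "g (proper_sums \<delta>) = \<delta>" if "\<delta> \<in> comps n" for \<delta>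
      using that inj_on_proper_sums by (simp add: g_def inv_into_f_f)
    have "0 = (\<Sum>\<delta>\<in>comps n. const (a \<delta>) * hivert_G N \<delta>) - (\<Sum>\<delta>\<in>comps n. const (b \<delta>) * hivert_G N \<delta>)"
      using assms(2,3) by (simp add: G_expansion_def)
    also have "\<dots> = (\<Sum>\<delta>\<in>comps n. const (a \<delta> - b \<delta>) * hivert_G N \<delta>)"
      by (simp add: sum_subtractf[symmetric] left_diff_distrib const_simps)
    also have "\<dots> = (\<Sum>\<delta>\<in>comps n. const (c (proper_sums \<delta>)) * hivert_of N n (proper_sums \<delta>))"
      by (intro sum.cong refl) (simp add: c_def g hivert_G_eq_hivert_of)
    also have "\<dots> = (\<Sum>C\<in>Pow {1..<n}. const (c C) * hivert_of N n C)"
      by (rule sum.reindex_bij_betw[OF bij_betw_proper_sums])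
    finally have "c (proper_sums \<gamma>) = 0"
      using hivert_of_independent[OF assms(1), of c "proper_sums \<gamma>"] proper_sums_subset[OF True] by simp
    then show ?thesis
      by (simp add: c_def g True)
  next
    case False
    then show ?thesis
      using assms(2,3) by (simp add: G_expansion_def)
  qed
qed

section \<open>Expansion of the quasisymmetric Schur polynomials\<close>

lemma Des_subset: "Des \<alpha> S \<subseteq> {1..<sum_list \<alpha>}"
  by (auto simp: Des_def)

lemma finite_standard [simp]: "finite (standard \<alpha>)"
proof (rule finite_subset)
  show "standard \<alpha> \<subseteq> diagram \<alpha> \<rightarrow>\<^sub>E {1..sum_list \<alpha>}"
  proof
    fix S assume S: "S \<in> standard \<alpha>"
    then have "S \<in> diagram \<alpha> \<rightarrow>\<^sub>E {1..}"
      by (simp add: standard_def ssct_def)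
    then show "S \<in> diagram \<alpha> \<rightarrow>\<^sub>E {1..sum_list \<alpha>}"
      using standard_in[OF S] by (meson PiE_iff)
  qed
qed (simp add: finite_PiE)

lemma relabel_cong:
  assumes "S \<in> standard \<alpha>" "\<And>p. p \<in> {1..sum_list \<alpha>} \<Longrightarrow> f p = g p"
  shows "relabel \<alpha> f S = relabel \<alpha> g S"
  unfolding relabel_def using standard_in[OF assms(1)] assms(2) by (intro restrict_ext) blast

lemma relabel_cell:
  assumes "S \<in> standard \<alpha>" "p \<in> {1..sum_list \<alpha>}"
  shows "relabel \<alpha> f S (cell \<alpha> S p) = f p"
  using cell_in[OF assms] by (simp add: relabel_def)

lemma compatible_word:
  assumes w: "w \<in> words N (sum_list \<alpha>) (Des \<alpha> S)"
  shows "compatible \<alpha> S (\<lambda>p. w ! (p - 1))"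
proof -
  have "w ! (p - 1) \<in> {1..N}" if "p \<in> {1..sum_list \<alpha>}" for p
  proof -
    have "w ! (p - 1) \<in> set w"
      using w that by (auto simp: words_def)
    then show ?thesis
      using w by (auto simp: words_def)
  qed
  moreover have "w ! (p - 1) \<le> w ! p" if "p \<in> {1..<sum_list \<alpha>}" for p
    using w that by (auto simp: words_def intro: sorted_nth_mono)
  ultimately show ?thesis
    using w by (fastforce simp: compatible_def words_def)
qed

text \<open>The inverse sends a tableau to its standardization together with its entries in reading
  order. The shift \<open>p - 1\<close> converts positions counted from 1 into list indices.\<close>

lemma bij_betw_relabel_words:
  fixes \<alpha> N
  defines "n \<equiv> sum_list \<alpha>"
  shows "bij_betw (\<lambda>(S, w). relabel \<alpha> (\<lambda>p. w ! (p - 1)) S)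
    (SIGMA S:standard \<alpha>. words N n (Des \<alpha> S)) {T. ssct \<alpha> T \<and> T ` diagram \<alpha> \<subseteq> {1..N}}"
proof (rule bij_betw_byWitness)
  let ?F = "\<lambda>(S, w). relabel \<alpha> (\<lambda>p. w ! (p - 1)) S"
  let ?w = "\<lambda>T. map (\<lambda>p. T (cell \<alpha> (std \<alpha> T) p)) [1..<Suc n]"
  let ?G = "\<lambda>T. (std \<alpha> T, ?w T)"
  let ?A = "SIGMA S:standard \<alpha>. words N n (Des \<alpha> S)"
  let ?B = "{T. ssct \<alpha> T \<and> T ` diagram \<alpha> \<subseteq> {1..N}}"
  have nth_w: "?w T ! (p - 1) = T (cell \<alpha> (std \<alpha> T) p)" if "p \<in> {1..n}" for T p
    using that by (cases p) (simp_all del: upt_Suc)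
  show "\<forall>a\<in>?A. ?G (?F a) = a"
  proof
    fix a assume "a \<in> ?A"
    then obtain S w where a: "a = (S, w)" and S: "S \<in> standard \<alpha>"
      and w: "w \<in> words N n (Des \<alpha> S)"
      by blast
    note c = compatible_word[OF w[unfolded n_def]]
    have "?w (relabel \<alpha> (\<lambda>p. w ! (p - 1)) S) = w"
    proof (rule nth_equalityI)
      show "length (?w (relabel \<alpha> (\<lambda>p. w ! (p - 1)) S)) = length w"
        using w by (simp add: words_def)
      fix i assume "i < length (?w (relabel \<alpha> (\<lambda>p. w ! (p - 1)) S))"
      then have "Suc i \<in> {1..n}"
        by (simp del: upt_Suc)
      then show "?w (relabel \<alpha> (\<lambda>p. w ! (p - 1)) S) ! i = w ! i"
        using nth_w[of "Suc i"] relabel_cell[OF S, of "Suc i"] unfolding std_relabel[OF S c]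
        by (simp add: n_def std_relabel[OF S c] del: upt_Suc)
    qed
    then show "?G (?F a) = a"
      by (simp only: a split prod.inject std_relabel[OF S c])
  qed
  show "\<forall>T\<in>?B. ?F (?G T) = T"
  proof
    fix T assume "T \<in> ?B"
    then have T: "ssct \<alpha> T"
      by simp
    have "?F (?G T) = relabel \<alpha> (\<lambda>p. T (cell \<alpha> (std \<alpha> T) p)) (std \<alpha> T)"
      unfolding split using nth_w by (intro relabel_cong std_standard[OF T]) (simp add: n_def)
    then show "?F (?G T) = T"
      by (simp only: relabel_std[OF T])
  qed
  show "?F ` ?A \<subseteq> ?B"
  proof clarify
    fix S w assume S: "S \<in> standard \<alpha>" and w: "w \<in> words N n (Des \<alpha> S)"
    note c = compatible_word[OF w[unfolded n_def]]
    have "w ! (S c - 1) \<in> {1..N}" if "c \<in> diagram \<alpha>" for c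
    proof -
      have "w ! (S c - 1) \<in> set w"
        using w standard_in[OF S that] by (auto simp: words_def n_def)
      then show ?thesis
        using w by (auto simp: words_def)
    qed
    then show "ssct \<alpha> (relabel \<alpha> (\<lambda>p. w ! (p - 1)) S) \<and>
        relabel \<alpha> (\<lambda>p. w ! (p - 1)) S ` diagram \<alpha> \<subseteq> {1..N}"
      using ssct_relabel[OF S c] by (auto simp: relabel_def)
  qed
  show "?G ` ?B \<subseteq> ?A"
  proof (rule image_subsetI)
    fix T assume "T \<in> ?B"
    then have T: "ssct \<alpha> T" and N: "T ` diagram \<alpha> \<subseteq> {1..N}"
      by simp_all
    note S = std_standard[OF T] and c = compatible_std[OF T]
    have "set (?w T) \<subseteq> {1..N}"
      using N cell_in(1)[OF S] by (fastforce simp: n_def)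
    moreover have "?w T ! (p - 1) \<le> ?w T ! p" if "p \<in> {1..<n}" for p
      using that c nth_w[of p T] nth_w[of "Suc p" T] by (simp add: compatible_def n_def del: upt_Suc)
    then have "sorted (?w T)"
      unfolding sorted_iff_nth_Suc by (metis (no_types, lifting) Suc_le_eq atLeastLessThan_iff
          diff_Suc_1 le_add1 length_map length_upt not_less_eq_eq plus_1_eq_Suc)
    moreover have "?w T ! (p - 1) < ?w T ! p" if "p \<in> Des \<alpha> (std \<alpha> T)" for p
    proof -
      have "p \<in> {1..<n}"
        using that Des_subset[of \<alpha> "std \<alpha> T"] by (auto simp: n_def)
      then show ?thesis
        using that c nth_w[of p T] nth_w[of "Suc p" T] by (simp add: compatible_def n_def del: upt_Suc)
    qed
    ultimately have "?w T \<in> words N n (Des \<alpha> (std \<alpha> T))"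
      by (simp add: words_def del: upt_Suc)
    then show "?G T \<in> ?A"
      using S by blast
  qed
qed

text \<open>Group the tableaux by their standardization \<open>S\<close>: the group of
  \<open>S\<close> is parametrized by the words that increase at \<open>Des \<alpha> S\<close>, and
  a tableau has the same weight as its word.\<close>

lemma quasi_schur_eq_sum_fundamental_of:
  assumes "\<alpha> \<in> comps n"
  shows "quasi_schur N \<alpha> = (\<Sum>S\<in>standard \<alpha>. fundamental_of N n (Des \<alpha> S))"
proof -
  have n: "sum_list \<alpha> = n"
    using assms by (simp add: comps_def)
  have weight: "(\<Prod>c\<in>diagram \<alpha>. X (relabel \<alpha> (\<lambda>p. w ! (p - 1)) S c)) = prod_list (map X w)"
    if S: "S \<in> standard \<alpha>" and w: "w \<in> words N n (Des \<alpha> S)" for S w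
  proof -
    have "(\<Prod>c\<in>diagram \<alpha>. X (relabel \<alpha> (\<lambda>p. w ! (p - 1)) S c)) = (\<Prod>c\<in>diagram \<alpha>. X (w ! (S c - 1)))"
      by (intro prod.cong refl) (simp add: relabel_def)
    also have "\<dots> = (\<Prod>p\<in>{1..n}. X (w ! (p - 1)))"
      using S by (intro prod.reindex_bij_betw) (simp add: standard_def n)
    also have "\<dots> = (\<Prod>i\<in>{0..<n}. X (w ! i))"
      by (rule prod.reindex_bij_witness[of _ Suc "\<lambda>p. p - 1"]) auto
    also have "\<dots> = prod_list (map X w)"
      using w by (simp add: prod.list_conv_set_nth words_def)
    finally show ?thesis .
  qed
  have "quasi_schur N \<alpha> = (\<Sum>(S, w)\<in>(SIGMA S:standard \<alpha>. words N n (Des \<alpha> S)).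
      \<Prod>c\<in>diagram \<alpha>. X (relabel \<alpha> (\<lambda>p. w ! (p - 1)) S c))"
    unfolding quasi_schur_def
    by (subst sum.reindex_bij_betw[OF bij_betw_relabel_words, symmetric])
      (simp add: n case_prod_beta')
  also have "\<dots> = (\<Sum>(S, w)\<in>(SIGMA S:standard \<alpha>. words N n (Des \<alpha> S)). prod_list (map X w))"
    using weight by (intro sum.cong refl) auto
  also have "\<dots> = (\<Sum>S\<in>standard \<alpha>. fundamental_of N n (Des \<alpha> S))"
    unfolding fundamental_of_def by (intro sum.Sigma[symmetric]) simp_all
  finally show ?thesis .
qed

section \<open>Tableaux of prescribed content\<close>

lemma psum_part: "1 \<le> i \<Longrightarrow> i \<le> length \<beta> \<Longrightarrow> psum \<beta> i = psum \<beta> (i - 1) + part \<beta> i"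
  using psum_Suc[of "i - 1" \<beta>] by (simp add: part_def)

text \<open>The positions of rank \<open>i\<close> form the half-open interval from
  \<open>psum \<beta> (i - 1)\<close> to \<open>psum \<beta> i\<close>.\<close>

lemma card_rank_eq:
  assumes b: "\<beta> \<in> comps n" and i: "i \<in> {1..length \<beta>}"
  shows "card {p \<in> {1..n}. rank (proper_sums \<beta>) p = i} = part \<beta> i"
proof -
  have n: "psum \<beta> i \<le> n"
    using psum_le_iff[OF b, of i "length \<beta>"] psum_length[OF b] i by simp
  have iff: "rank (proper_sums \<beta>) p = i \<longleftrightarrow> p \<in> {psum \<beta> (i - 1)<..psum \<beta> i}" if "p \<in> {1..n}" for p
    using rank_le_iff[OF b that, of i] rank_le_iff[OF b that, of "i - 1"] i by (cases i) auto
  have "{p \<in> {1..n}. rank (proper_sums \<beta>) p = i} = {p \<in> {1..n}. p \<in> {psum \<beta> (i - 1)<..psum \<beta> i}}"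
    by (intro Collect_cong conj_cong refl iff)
  also have "\<dots> = {psum \<beta> (i - 1)<..psum \<beta> i}"
    using n by auto
  finally show ?thesis
    using psum_part[of i \<beta>] i by simp
qed

lemma compatible_rank:
  assumes "\<alpha> \<in> comps n" "\<beta> \<in> comps n" "Des \<alpha> S \<subseteq> proper_sums \<beta>"
  shows "compatible \<alpha> S (rank (proper_sums \<beta>))"
  using assms rank_less_Suc_iff[OF finite_proper_sums[of \<beta>]] rank_ge_1 rank_mono
  by (auto simp: compatible_def)

lemma card_entries_le:
  assumes T: "T \<in> SSCT \<alpha> \<beta>" and "i \<le> length \<beta>"
  shows "card {c \<in> diagram \<alpha>. T c \<le> i} = psum \<beta> i"
  using assms(2)
proof (induction i)
  case 0
  have "T c \<noteq> 0" if "c \<in> diagram \<alpha>" for c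
    using T that by (auto simp: SSCT_def)
  then show ?case
    by auto
next
  case (Suc i)
  have "{c \<in> diagram \<alpha>. T c \<le> Suc i} = {c \<in> diagram \<alpha>. T c \<le> i} \<union> {c \<in> diagram \<alpha>. T c = Suc i}"
    by auto
  moreover have "card \<dots> = card {c \<in> diagram \<alpha>. T c \<le> i} + card {c \<in> diagram \<alpha>. T c = Suc i}"
    by (intro card_Un_disjoint) auto
  moreover have "card {c \<in> diagram \<alpha>. T c = Suc i} = part \<beta> (Suc i)"
    using T Suc.prems by (auto simp: SSCT_def)
  ultimately show ?case
    using Suc psum_part[of "Suc i" \<beta>] by simp
qed

text \<open>The cells with entries up to \<open>i\<close> form an initial segment of the reading
  order, of length \<open>psum \<beta> i\<close> by the content. So \<open>T c\<close> and the rank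
  of the position of \<open>c\<close> have the same upper bounds among the numbers up to
  \<open>length \<beta>\<close>, and they coincide. The content thus leaves no choice of labels once
  the standardization is known.\<close>

lemma SSCT_eq_rank_std:
  assumes T: "T \<in> SSCT \<alpha> \<beta>" and b: "\<beta> \<in> comps n" and a: "\<alpha> \<in> comps n"
    and c: "c \<in> diagram \<alpha>"
  shows "T c = rank (proper_sums \<beta>) (std \<alpha> T c)"
proof -
  have ssct: "ssct \<alpha> T" and Tc: "T c \<in> {1..length \<beta>}"
    using T c by (auto simp: SSCT_def)
  have Sc: "std \<alpha> T c \<in> {1..n}"
    using standard_in[OF std_standard[OF ssct] c] a by (simp add: comps_def)
  have iff: "T c \<le> i \<longleftrightarrow> rank (proper_sums \<beta>) (std \<alpha> T c) \<le> i" if i: "i \<le> length \<beta>" for i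
  proof -
    have "T c \<le> i \<longleftrightarrow> std \<alpha> T c \<le> psum \<beta> i"
    proof
      assume "T c \<le> i"
      then have "{d \<in> diagram \<alpha>. before T d c} \<subseteq> {d \<in> diagram \<alpha>. T d \<le> i}"
        by (auto simp: before_def)
      then have "std \<alpha> T c \<le> card {d \<in> diagram \<alpha>. T d \<le> i}"
        using c by (auto simp: std_def intro!: card_mono)
      then show "std \<alpha> T c \<le> psum \<beta> i"
        by (simp add: card_entries_le[OF T i])
    next
      assume le: "std \<alpha> T c \<le> psum \<beta> i"
      show "T c \<le> i"
      proof (rule ccontr)
        assume n: "\<not> T c \<le> i"
        have "{d \<in> diagram \<alpha>. T d \<le> i} \<subseteq> {d \<in> diagram \<alpha>. before T d c}"
          using n by (auto simp: before_def)
        moreover have "c \<in> {d \<in> diagram \<alpha>. before T d c}" "c \<notin> {d \<in> diagram \<alpha>. T d \<le> i}"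
          using c n before_refl by blast+
        ultimately have "{d \<in> diagram \<alpha>. T d \<le> i} \<subset> {d \<in> diagram \<alpha>. before T d c}"
          by blast
        then have "card {d \<in> diagram \<alpha>. T d \<le> i} < std \<alpha> T c"
          using c by (auto simp: std_def intro!: psubset_card_mono)
        then show False
          using le by (simp add: card_entries_le[OF T i])
      qed
    qed
    then show ?thesis
      using rank_le_iff[OF b Sc i] by simp
  qed
  show ?thesis
    using iff[of "T c"] iff[of "rank (proper_sums \<beta>) (std \<alpha> T c)"] rank_le_length[OF b Sc] Tc by auto
qed

text \<open>By \<open>SSCT_eq_rank_std\<close> the only possible labels are the ranks. They jump
  exactly at the cuts of \<beta>, so they are compatible with \<open>S\<close> iff every descent of
  \<open>S\<close> is a cut.\<close>

lemma bij_betw_relabel_SSCT: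
  assumes a: "\<alpha> \<in> comps n" and b: "\<beta> \<in> comps n"
  shows "bij_betw (relabel \<alpha> (rank (proper_sums \<beta>)))
    {S \<in> standard \<alpha>. Des \<alpha> S \<subseteq> proper_sums \<beta>} (SSCT \<alpha> \<beta>)"
proof (rule bij_betw_byWitness[where f' = "std \<alpha>"])
  let ?r = "rank (proper_sums \<beta>)"
  let ?A = "{S \<in> standard \<alpha>. Des \<alpha> S \<subseteq> proper_sums \<beta>}"
  have n: "sum_list \<alpha> = n"
    using a by (simp add: comps_def)
  have relabel_std: "relabel \<alpha> ?r (std \<alpha> T) = T" if T: "T \<in> SSCT \<alpha> \<beta>" for T
  proof -
    have "relabel \<alpha> ?r (std \<alpha> T) = restrict T (diagram \<alpha>)"
      unfolding relabel_def using SSCT_eq_rank_std[OF T b a] by (intro restrict_ext) simp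
    moreover have "T \<in> diagram \<alpha> \<rightarrow>\<^sub>E {1..}"
      using T by (simp add: SSCT_def ssct_def)
    ultimately show ?thesis
      by (metis PiE_restrict)
  qed
  show "\<forall>S\<in>?A. std \<alpha> (relabel \<alpha> ?r S) = S"
    using std_relabel compatible_rank[OF a b] by blast
  show "\<forall>T\<in>SSCT \<alpha> \<beta>. relabel \<alpha> ?r (std \<alpha> T) = T"
    using relabel_std by blast
  show "relabel \<alpha> ?r ` ?A \<subseteq> SSCT \<alpha> \<beta>"
  proof (rule image_subsetI)
    fix S assume "S \<in> ?A"
    then have S: "S \<in> standard \<alpha>" and c: "compatible \<alpha> S ?r"
      using compatible_rank[OF a b] by auto
    have "relabel \<alpha> ?r S ` diagram \<alpha> \<subseteq> {1..length \<beta>}"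
      using standard_in[OF S] rank_le_length[OF b] rank_ge_1 by (auto simp: relabel_def n)
    moreover have "card {c \<in> diagram \<alpha>. relabel \<alpha> ?r S c = i} = part \<beta> i"
      if i: "i \<in> {1..length \<beta>}" for i
    proof -
      have bij: "bij_betw S (diagram \<alpha>) {1..n}"
        using S by (simp add: standard_def n)
      have "bij_betw S {c \<in> diagram \<alpha>. relabel \<alpha> ?r S c = i} {p \<in> {1..n}. ?r p = i}"
      proof (rule bij_betw_imageI)
        show "inj_on S {c \<in> diagram \<alpha>. relabel \<alpha> ?r S c = i}"
          using bij by (auto simp: bij_betw_def intro: inj_on_subset)
        have "S ` diagram \<alpha> = {1..n}"
          using bij by (simp add: bij_betw_def)
        then have "{p \<in> {1..n}. ?r p = i} = {p \<in> S ` diagram \<alpha>. ?r p = i}"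
          by simp
        also have "\<dots> = S ` {c \<in> diagram \<alpha>. relabel \<alpha> ?r S c = i}"
          by (auto simp: relabel_def)
        finally show "S ` {c \<in> diagram \<alpha>. relabel \<alpha> ?r S c = i} = {p \<in> {1..n}. ?r p = i}" ..
      qed
      then have "card {c \<in> diagram \<alpha>. relabel \<alpha> ?r S c = i} = card {p \<in> {1..n}. ?r p = i}"
        by (rule bij_betw_same_card)
      then show ?thesis
        by (simp only: card_rank_eq[OF b i])
    qed
    ultimately show "relabel \<alpha> ?r S \<in> SSCT \<alpha> \<beta>"
      using ssct_relabel[OF S c] by (simp add: SSCT_def)
  qed
  show "std \<alpha> ` SSCT \<alpha> \<beta> \<subseteq> ?A"
  proof (rule image_subsetI)
    fix T assume T: "T \<in> SSCT \<alpha> \<beta>"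
    then have ssct: "ssct \<alpha> T"
      by (simp add: SSCT_def)
    note S = std_standard[OF ssct]
    have "Des \<alpha> (std \<alpha> T) \<subseteq> proper_sums \<beta>"
    proof
      fix p assume p: "p \<in> Des \<alpha> (std \<alpha> T)"
      then have pn: "p \<in> {1..<n}"
        using Des_subset n by blast
      have "T (cell \<alpha> (std \<alpha> T) q) = ?r q" if "q \<in> {1..n}" for q
        using SSCT_eq_rank_std[OF T b a] cell_in[OF S] that n by simp
      then have "?r p < ?r (Suc p)"
        using compatible_std[OF ssct] p pn by (auto simp: compatible_def n)
      then show "p \<in> proper_sums \<beta>"
        using rank_less_Suc_iff finite_proper_sums by blast
    qed
    then show "std \<alpha> T \<in> ?A"
      using S by simp
  qed
qed

section \<open>Ascents\<close>

text \<open>The value \<open>i\<close> fills the positions after \<open>psum \<beta> (i - 1)\<close>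
  up to \<open>psum \<beta> i\<close>, moving left. Its leftmost occurrence is at position
  \<open>psum \<beta> i\<close>, and the rightmost occurrence of \<open>i + 1\<close> is at the next
  position. Hence \<open>i\<close> is an ascent iff the cut \<open>psum \<beta> i\<close> is not a
  descent, and the rank of that cut is \<open>i\<close>.\<close>

lemma SumAsc_relabel:
  assumes a: "\<alpha> \<in> comps n" and b: "\<beta> \<in> comps n"
    and S: "S \<in> standard \<alpha>" and Des: "Des \<alpha> S \<subseteq> proper_sums \<beta>"
  shows "SumAsc \<alpha> (relabel \<alpha> (rank (proper_sums \<beta>)) S) =
    (\<Sum>x\<in>proper_sums \<beta> - Des \<alpha> S. rank (proper_sums \<beta>) x)"
proof -
  let ?r = "rank (proper_sums \<beta>)" and ?T = "relabel \<alpha> (rank (proper_sums \<beta>)) S"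
  let ?col = "\<lambda>p. snd (cell \<alpha> S p)"
  have n: "sum_list \<alpha> = n"
    using a by (simp add: comps_def)
  note comp = compatible_rank[OF a b Des]
  have cols: "columns_of \<alpha> ?T v = ?col ` {p \<in> {1..n}. ?r p = v}" for v
  proof (intro equalityI subsetI)
    fix k assume "k \<in> columns_of \<alpha> ?T v"
    then obtain r where r: "(r, k) \<in> diagram \<alpha>" "?r (S (r, k)) = v"
      by (auto simp: columns_of_def relabel_def)
    then show "k \<in> ?col ` {p \<in> {1..n}. ?r p = v}"
      using standard_in[OF S r(1)] cell_standard[OF S r(1)] n by (intro image_eqI[of _ _ "S (r, k)"]) auto
  next
    fix k assume "k \<in> ?col ` {p \<in> {1..n}. ?r p = v}"
    then obtain p where p: "p \<in> {1..n}" "?r p = v" "k = ?col p"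
      by blast
    then show "k \<in> columns_of \<alpha> ?T v"
      using cell_in[OF S, of p] n unfolding columns_of_def relabel_def
      by (auto intro!: exI[of _ "fst (cell \<alpha> S p)"])
  qed
  have psum_n: "psum \<beta> i \<in> {1..n}" if "i \<in> {1..length \<beta>}" for i
    using psum_le_iff[OF b, of i "length \<beta>"] psum_less[OF b, of 0 i] psum_length[OF b] that by simp
  have psum_Suc_n: "Suc (psum \<beta> (i - 1)) \<in> {1..n}" if "i \<in> {1..length \<beta>}" for i
    using psum_less[OF b, of "i - 1" "length \<beta>"] psum_length[OF b] that by (cases i) simp_all
  have rank_psum_Suc: "?r (Suc (psum \<beta> (i - 1))) = i" if "i \<in> {1..length \<beta>}" for i
    using rank_proper_sums[OF b, of "i - 1" "Suc (psum \<beta> (i - 1))"] psum_less[OF b, of "i - 1" i] that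
    by (cases i) simp_all
  \<comment> \<open>All parts of \<beta> are positive, so each value up to
    \<open>length \<beta>\<close> occurs; the nonemptiness conditions in \<open>Asc\<close> become
    bounds on \<open>i\<close>.\<close>
  have ne_iff: "columns_of \<alpha> ?T v \<noteq> {} \<longleftrightarrow> v \<in> {1..length \<beta>}" for v
  proof
    show "v \<in> {1..length \<beta>}" if "columns_of \<alpha> ?T v \<noteq> {}"
      using that rank_le_length[OF b] rank_ge_1 by (auto simp: cols)
    show "columns_of \<alpha> ?T v \<noteq> {}" if "v \<in> {1..length \<beta>}"
      using psum_Suc_n[OF that] rank_psum_Suc[OF that] by (auto simp: cols)
  qed
  have decreasing: "?col q \<le> ?col p" if "p \<in> {1..n}" "q \<in> {1..n}" "p \<le> q" "?r p = ?r q" for p q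
    using compatible_less[OF comp, of p q] that n by (cases "p = q") auto
  have fin: "finite (columns_of \<alpha> ?T v)" for v
    by (simp add: cols)
  have Min: "Min (columns_of \<alpha> ?T v) = ?col (psum \<beta> v)" if v: "v \<in> {1..length \<beta>}" for v
  proof (rule Min_eqI[OF fin])
    show "?col (psum \<beta> v) \<in> columns_of \<alpha> ?T v"
      using psum_n[OF v] rank_psum[OF b, of v] v by (auto simp: cols)
    fix k assume "k \<in> columns_of \<alpha> ?T v"
    then obtain p where p: "p \<in> {1..n}" "?r p = v" "k = ?col p"
      by (auto simp: cols)
    then show "?col (psum \<beta> v) \<le> k"
      using decreasing[of p "psum \<beta> v"] psum_n[OF v] rank_psum[OF b, of v] rank_le_iff[OF b p(1), of v] v
      by simp
  qed
  have Max: "Max (columns_of \<alpha> ?T v) = ?col (Suc (psum \<beta> (v - 1)))" if v: "v \<in> {1..length \<beta>}" for v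
  proof (rule Max_eqI[OF fin])
    show "?col (Suc (psum \<beta> (v - 1))) \<in> columns_of \<alpha> ?T v"
      using psum_Suc_n[OF v] rank_psum_Suc[OF v] by (auto simp: cols)
    fix k assume "k \<in> columns_of \<alpha> ?T v"
    then obtain p where p: "p \<in> {1..n}" "?r p = v" "k = ?col p"
      by (auto simp: cols)
    moreover have "\<not> ?r p \<le> v - 1"
      using p v by auto
    ultimately show "k \<le> ?col (Suc (psum \<beta> (v - 1)))"
      using decreasing[of "Suc (psum \<beta> (v - 1))" p] psum_Suc_n[OF v] rank_psum_Suc[OF v]
        rank_le_iff[OF b p(1), of "v - 1"] v by simp
  qed
  have Asc: "Asc \<alpha> ?T = {i \<in> {1..<length \<beta>}. psum \<beta> i \<notin> Des \<alpha> S}"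
  proof (intro set_eqI)
    fix i
    have "i \<in> Asc \<alpha> ?T \<longleftrightarrow> i \<in> {1..length \<beta>} \<and> i + 1 \<in> {1..length \<beta>} \<and>
        Max (columns_of \<alpha> ?T (i + 1)) < Min (columns_of \<alpha> ?T i)"
      unfolding Asc_def mem_Collect_eq ne_iff ..
    also have "\<dots> \<longleftrightarrow> i \<in> {1..<length \<beta>} \<and> ?col (Suc (psum \<beta> i)) < ?col (psum \<beta> i)"
      using Min[of i] Max[of "i + 1"] by auto
    also have "\<dots> \<longleftrightarrow> i \<in> {1..<length \<beta>} \<and> psum \<beta> i \<notin> Des \<alpha> S"
    proof (rule conj_cong[OF refl])
      assume "i \<in> {1..<length \<beta>}"
      then have "psum \<beta> i \<in> {1..<n}"
        using psum_n[of i] psum_less[OF b, of i "length \<beta>"] psum_length[OF b] by simp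
      then show "?col (Suc (psum \<beta> i)) < ?col (psum \<beta> i) \<longleftrightarrow> psum \<beta> i \<notin> Des \<alpha> S"
        by (auto simp: Des_def n)
    qed
    finally show "i \<in> Asc \<alpha> ?T \<longleftrightarrow> i \<in> {i \<in> {1..<length \<beta>}. psum \<beta> i \<notin> Des \<alpha> S}"
      by simp
  qed
  have "proper_sums \<beta> - Des \<alpha> S = psum \<beta> ` Asc \<alpha> ?T"
    unfolding Asc by (auto simp: proper_sums_eq)
  moreover have "inj_on (psum \<beta>) (Asc \<alpha> ?T)"
    unfolding Asc by (rule inj_on_subset[OF inj_on_psum[OF b]]) auto
  ultimately have "(\<Sum>x\<in>proper_sums \<beta> - Des \<alpha> S. ?r x) = (\<Sum>i\<in>Asc \<alpha> ?T. ?r (psum \<beta> i))"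
    by (simp add: sum.reindex)
  also have "\<dots> = \<Sum>(Asc \<alpha> ?T)"
    unfolding Asc by (intro sum.cong refl rank_psum[OF b]) auto
  finally show ?thesis
    by (simp add: SumAsc_def)
qed

section \<open>Collecting the coefficients\<close>

text \<open>Expand every \<open>fundamental_of N n (Des \<alpha> S)\<close> and exchange the sums.
  The cut set \<open>C\<close> receives one power of \<open>t\<close> from each \<open>S\<close>
  with descents in \<open>C\<close>; for the cuts of \<beta> these \<open>S\<close> correspond to
  \<open>SSCT \<alpha> \<beta>\<close>, with exponent \<open>SumAsc\<close>.\<close>

lemma G_expansion_quasi_schur:
  assumes a: "\<alpha> \<in> comps n"
  shows "G_expansion N n (quasi_schur N \<alpha>)
    (\<lambda>\<beta>. if \<beta> \<in> comps n then \<Sum>T\<in>SSCT \<alpha> \<beta>. t ^ SumAsc \<alpha> T else 0)"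
proof -
  let ?U = "{1..<n}"
  let ?g = "\<lambda>C S. t ^ (\<Sum>x\<in>C - Des \<alpha> S. rank C x)"
  have n: "sum_list \<alpha> = n"
    using a by (simp add: comps_def)
  have coeff: "(\<Sum>T\<in>SSCT \<alpha> \<beta>. t ^ SumAsc \<alpha> T) =
      (\<Sum>S | S \<in> standard \<alpha> \<and> Des \<alpha> S \<subseteq> proper_sums \<beta>. ?g (proper_sums \<beta>) S)"
    if b: "\<beta> \<in> comps n" for \<beta>
    unfolding sum.reindex_bij_betw[OF bij_betw_relabel_SSCT[OF a b], symmetric]
    by (intro sum.cong refl) (simp add: SumAsc_relabel[OF a b])
  have "quasi_schur N \<alpha> = (\<Sum>S\<in>standard \<alpha>. \<Sum>C\<in>{Des \<alpha> S..?U}. const (?g C S) * hivert_of N n C)"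
    unfolding quasi_schur_eq_sum_fundamental_of[OF a] using Des_subset n
    by (intro sum.cong refl fundamental_of_eq_sum_hivert_of) blast
  also have "\<dots> = (\<Sum>S\<in>standard \<alpha>. \<Sum>C | C \<in> Pow ?U \<and> Des \<alpha> S \<subseteq> C. const (?g C S) * hivert_of N n C)"
    by (intro sum.cong refl set_eqI) (simp only: atLeastAtMost_iff mem_Collect_eq Pow_iff conj_commute)
  also have "\<dots> = (\<Sum>C\<in>Pow ?U. \<Sum>S | S \<in> standard \<alpha> \<and> Des \<alpha> S \<subseteq> C. const (?g C S) * hivert_of N n C)"
    by (intro sum.swap_restrict) simp_all
  also have "\<dots> = (\<Sum>C\<in>Pow ?U. const (\<Sum>S | S \<in> standard \<alpha> \<and> Des \<alpha> S \<subseteq> C. ?g C S) * hivert_of N n C)"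
    by (simp only: const_sum sum_distrib_right)
  also have "\<dots> = (\<Sum>\<beta>\<in>comps n. const (\<Sum>S | S \<in> standard \<alpha> \<and> Des \<alpha> S \<subseteq> proper_sums \<beta>.
      ?g (proper_sums \<beta>) S) * hivert_of N n (proper_sums \<beta>))"
    by (rule sum.reindex_bij_betw[OF bij_betw_proper_sums, symmetric])
  also have "\<dots> = (\<Sum>\<beta>\<in>comps n. const (if \<beta> \<in> comps n then \<Sum>T\<in>SSCT \<alpha> \<beta>. t ^ SumAsc \<alpha> T else 0) *
      hivert_G N \<beta>)"
    by (intro sum.cong refl) (simp only: coeff hivert_G_eq_hivert_of if_True)
  finally show ?thesis
    by (simp add: G_expansion_def)
qed

theorem theorem5p5:
  fixes n N :: nat and \<alpha> \<beta> :: "nat list"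
  assumes "\<alpha> \<in> comps n" and "\<beta> \<in> comps n" and "N \<ge> n"
  shows "(\<exists>!a. G_expansion N n (quasi_schur N \<alpha>) a) \<and>
         (\<forall>a. G_expansion N n (quasi_schur N \<alpha>) a \<longrightarrow>
                a \<beta> = (\<Sum>T\<in>SSCT \<alpha> \<beta>. t ^ SumAsc \<alpha> T))"
proof -
  \<comment> \<open>The value 0 outside \<open>comps n\<close> is the one prescribed by
    \<open>G_expansion\<close>.\<close>
  let ?a = "\<lambda>\<beta>. if \<beta> \<in> comps n then \<Sum>T\<in>SSCT \<alpha> \<beta>. t ^ SumAsc \<alpha> T else 0"
  have ex: "G_expansion N n (quasi_schur N \<alpha>) ?a"
    by (rule G_expansion_quasi_schur[OF assms(1)])
  have unique: "a = ?a" if "G_expansion N n (quasi_schur N \<alpha>) a" for a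
    using that ex by (rule G_expansion_unique[OF assms(3)])
  have "a \<beta> = (\<Sum>T\<in>SSCT \<alpha> \<beta>. t ^ SumAsc \<alpha> T)"
    if "G_expansion N n (quasi_schur N \<alpha>) a" for a
    using unique[OF that] assms(2) by simp
  with ex unique show ?thesis
    by blast
qed

end
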